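(* For every $n\in\mathbb{N}=\{1,2,\ldots\}$ there exists a holomorphic contact form $\alpha$ on $\mathbb{C}^{2n+1}$ such that the complex contact manifold $(\mathbb{C}^{2n+1},\xi=\ker\alpha)$ is (Kobayashi) hyperbolic.
   Context: A holomorphic contact form on a complex manifold $M$ of dimension $2n+1\ge 3$ is a holomorphic $1$-form $\alpha$ on $M$ with $\alpha\wedge(d\alpha)^n\neq 0$ at every point of $M$. Let $\mathbb{D}=\{\zeta\in\mathbb{C}:|\zeta|<1\}$. Let $M$ be a complex manifold and $\xi\subset TM$ a holomorphic vector subbundle. A holomorphic disk $f\colon\mathbb{D}\to M$ is horizontal (tangential to $\xi$) if $f'(\zeta)\in\xi|_{f(\zeta)}$ for all $\zeta\in\mathbb{D}$. For $p\in M$ and $v\in\xi_p$ set $$|v|_\xi=\inf\left\{\frac{1}{|\lambda|}:\ \exists f\colon\mathbb{D}\to M \text{ holomorphic and horizontal},\ f(0)=p,\ f'(0)=\lambda v\right\},$$ where $\lambda$ ranges over nonzero complex numbers. The directed Kobayashi pseudodistance is $$d_\xi(p,q)=\inf_\gamma\int_0^1|\gamma'(t)|_\xi\,dt,\qquad p,q\in M,$$ where the infimum is over all piecewise smooth paths $\gamma\colon[0,1]\to M$ satisfying $\gamma(0)=p$, $\gamma(1)=q$ and $\gamma'(t)\in\xi_{\gamma(t)}$ for all $t\in[0,1]$. The directed manifold $(M,\xi)$ is called (Kobayashi) hyperbolic if $d_\xi$ is a distance function on $M$, i.e., $d_\xi(p,q)>0$ for all pairs of distinct points $p,q\in M$.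 *)

theory Defs
  imports "HOL-Analysis.Analysis"
begin

section \<open>Alternating forms at a point\<close>

text \<open>
  A form of degree \<open>k\<close> on a vector space is represented as a function of a sequence
  \<open>v 0, v 1, \<dots>\<close> of vectors which depends only on \<open>v 0, \<dots>, v (k - 1)\<close>.
  The wedge product is normalised so that \<open>\<alpha> \<and> \<beta>\<close> maps \<open>(u, v)\<close> to
  \<open>\<alpha> u * \<beta> v - \<alpha> v * \<beta> u\<close> for 1-forms \<open>\<alpha>\<close>, \<open>\<beta>\<close>.
\<close>

type_synonym 'a form = "(nat \<Rightarrow> 'a) \<Rightarrow> complex"

definition wedge :: "nat \<Rightarrow> nat \<Rightarrow> 'a form \<Rightarrow> 'a form \<Rightarrow> 'a form" where
  "wedge k l \<omega> \<eta> = (\<lambda>v. (\<Sum>\<sigma> | \<sigma> permutes {..<k + l}.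
      of_int (sign \<sigma>) * \<omega> (\<lambda>i. v (\<sigma> i)) * \<eta> (\<lambda>i. v (\<sigma> (k + i)))) / (fact k * fact l))"

primrec wedge_power :: "nat \<Rightarrow> 'a form \<Rightarrow> nat \<Rightarrow> 'a form" where
  "wedge_power k \<omega> 0 = (\<lambda>v. 1)"
| "wedge_power k \<omega> (Suc j) = wedge k (j * k) \<omega> (wedge_power k \<omega> j)"


section \<open>Holomorphic 1-forms and contact forms on complex coordinate space\<close>

definition holomorphic_function :: "(complex ^ 'm \<Rightarrow> complex) \<Rightarrow> bool" where
  "holomorphic_function f \<longleftrightarrow>
     (\<forall>z. \<exists>D. (f has_derivative D) (at z) \<and> Vector_Spaces.linear (*s) (*) D)"

text \<open>A 1-form is given by its values \<open>\<alpha> z v\<close> on tangent vectors \<open>v\<close> at points \<open>z\<close>.\<close>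

definition holomorphic_1form :: "(complex ^ 'm \<Rightarrow> complex ^ 'm \<Rightarrow> complex) \<Rightarrow> bool" where
  "holomorphic_1form \<alpha> \<longleftrightarrow>
     (\<forall>z. Vector_Spaces.linear (*s) (*) (\<alpha> z)) \<and>
     (\<forall>v. holomorphic_function (\<lambda>z. \<alpha> z v))"

text \<open>
  The usual formula \<open>d\<alpha>(X, Y) = X(\<alpha>(Y)) - Y(\<alpha>(X)) - \<alpha>([X, Y])\<close>, applied to the
  constant vector fields \<open>X = v 0\<close> and \<open>Y = v 1\<close>.
\<close>

definition ext_deriv ::
  "(complex ^ 'm \<Rightarrow> complex ^ 'm \<Rightarrow> complex) \<Rightarrow> complex ^ 'm \<Rightarrow> (complex ^ 'm) form" where
  "ext_deriv \<alpha> z = (\<lambda>v. frechet_derivative (\<lambda>w. \<alpha> w (v 1)) (at z) (v 0)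
                       - frechet_derivative (\<lambda>w. \<alpha> w (v 0)) (at z) (v 1))"

text \<open>Meant for \<open>CARD('m) = 2 * n + 1\<close>, when \<open>\<alpha> \<and> (d\<alpha>)\<^sup>n\<close> is a form of top degree.\<close>

definition holomorphic_contact_form ::
  "nat \<Rightarrow> (complex ^ 'm \<Rightarrow> complex ^ 'm \<Rightarrow> complex) \<Rightarrow> bool" where
  "holomorphic_contact_form n \<alpha> \<longleftrightarrow> holomorphic_1form \<alpha> \<and>
     (\<forall>z. wedge 1 (2 * n) (\<lambda>v. \<alpha> z (v 0)) (wedge_power 2 (ext_deriv \<alpha> z) n) \<noteq> (\<lambda>v. 0))"

definition kernel_bundle ::
  "(complex ^ 'm \<Rightarrow> complex ^ 'm \<Rightarrow> complex) \<Rightarrow> complex ^ 'm \<Rightarrow> (complex ^ 'm) set" where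
  "kernel_bundle \<alpha> z = {v. \<alpha> z v = 0}"


section \<open>The directed Kobayashi pseudodistance\<close>

text \<open>
  A subbundle \<open>\<xi>\<close> of the tangent bundle of complex coordinate space is given by its
  fibres \<open>\<xi> z\<close>. Only the values on the open unit disk matter for a disk
  \<open>f :: complex \<Rightarrow> complex ^ 'm\<close>.
\<close>

definition complex_velocity :: "(complex \<Rightarrow> complex ^ 'm) \<Rightarrow> complex \<Rightarrow> complex ^ 'm" where
  "complex_velocity f \<zeta> = (\<chi> i. deriv (\<lambda>w. f w $ i) \<zeta>)"

definition horizontal_disk ::
  "(complex ^ 'm \<Rightarrow> (complex ^ 'm) set) \<Rightarrow> (complex \<Rightarrow> complex ^ 'm) \<Rightarrow> bool" where
  "horizontal_disk \<xi> f \<longleftrightarrow>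
     (\<forall>i. (\<lambda>\<zeta>. f \<zeta> $ i) holomorphic_on ball 0 1) \<and>
     (\<forall>\<zeta>\<in>ball 0 1. complex_velocity f \<zeta> \<in> \<xi> (f \<zeta>))"

text \<open>
  Infima are taken in the extended nonnegative reals, so that an infimum over the empty
  set is \<open>\<infinity>\<close>.
\<close>

definition directed_norm ::
  "(complex ^ 'm \<Rightarrow> (complex ^ 'm) set) \<Rightarrow> complex ^ 'm \<Rightarrow> complex ^ 'm \<Rightarrow> ennreal" where
  "directed_norm \<xi> p v = Inf {ennreal (1 / cmod c) | c.
     c \<noteq> 0 \<and> (\<exists>f. horizontal_disk \<xi> f \<and> f 0 = p \<and> complex_velocity f 0 = c *s v)}"

text \<open>Infinitely differentiable on \<open>{a..b}\<close>, with one-sided derivatives at the end points;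
  \<open>g k\<close> is the \<open>k\<close>-th derivative.\<close>

definition smooth_on_interval :: "real \<Rightarrow> real \<Rightarrow> (real \<Rightarrow> 'a::real_normed_vector) \<Rightarrow> bool" where
  "smooth_on_interval a b \<gamma> \<longleftrightarrow> (\<exists>g :: nat \<Rightarrow> real \<Rightarrow> 'a. g 0 = \<gamma> \<and>
     (\<forall>k. \<forall>t\<in>{a..b}. (g k has_vector_derivative g (Suc k) t) (at t within {a..b})))"

text \<open>At a break point \<open>s i\<close> both one-sided derivatives are required to be tangential to \<open>\<xi>\<close>.
  Continuity at the break points follows from smoothness on the closed pieces.\<close>

definition horizontal_path ::
  "(complex ^ 'm \<Rightarrow> (complex ^ 'm) set) \<Rightarrow> (real \<Rightarrow> complex ^ 'm) \<Rightarrow> bool" where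
  "horizontal_path \<xi> \<gamma> \<longleftrightarrow> (\<exists>(N::nat) (s :: nat \<Rightarrow> real). s 0 = 0 \<and> s N = 1 \<and>
     (\<forall>i<N. s i < s (Suc i) \<and> smooth_on_interval (s i) (s (Suc i)) \<gamma> \<and>
        (\<forall>t\<in>{s i..s (Suc i)}.
           vector_derivative \<gamma> (at t within {s i..s (Suc i)}) \<in> \<xi> (\<gamma> t))))"

text \<open>The finitely many break points, where the derivative in the integrand need not exist,
  form a null set.\<close>

definition directed_length ::
  "(complex ^ 'm \<Rightarrow> (complex ^ 'm) set) \<Rightarrow> (real \<Rightarrow> complex ^ 'm) \<Rightarrow> ennreal" where
  "directed_length \<xi> \<gamma> =
     (\<integral>\<^sup>+t\<in>{0..1}. directed_norm \<xi> (\<gamma> t) (vector_derivative \<gamma> (at t within {0..1})) \<partial>lborel)"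

definition directed_kobayashi_dist ::
  "(complex ^ 'm \<Rightarrow> (complex ^ 'm) set) \<Rightarrow> complex ^ 'm \<Rightarrow> complex ^ 'm \<Rightarrow> ennreal" where
  "directed_kobayashi_dist \<xi> p q =
     Inf {directed_length \<xi> \<gamma> | \<gamma>. horizontal_path \<xi> \<gamma> \<and> \<gamma> 0 = p \<and> \<gamma> 1 = q}"

definition kobayashi_hyperbolic :: "(complex ^ 'm \<Rightarrow> (complex ^ 'm) set) \<Rightarrow> bool" where
  "kobayashi_hyperbolic \<xi> \<longleftrightarrow> (\<forall>p q. p \<noteq> q \<longrightarrow> directed_kobayashi_dist \<xi> p q > 0)"

end

theory Submission
  imports Defs "HOL-Complex_Analysis.Great_Picard"
begin

text \<open>
  Write the points of complex space of dimension \<open>2 n + 1\<close> as \<open>(c, w)\<close> with \<open>c = (c\<^sub>0, \<dots>, c\<^sub>2\<^sub>n\<^sub>-\<^sub>1)\<close>,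
  and let \<open>E(c) = \<Sum> P\<^sub>i(c\<^sub>i)\<close> be a sum of entire functions of one variable. The map
  \<open>(c, w) \<mapsto> (c, z)\<close> with \<open>z = e\<^sup>w + E(c)\<close> is locally biholomorphic and its image is the complement of the graph
  of \<open>E\<close>. The form wanted is the pullback of the standard contact form
  \<open>dz - \<Sum> c\<^sub>2\<^sub>j dc\<^sub>2\<^sub>j\<^sub>+\<^sub>1\<close> under this map, namely
  \<open>\<alpha> = e\<^sup>w dw + \<Sum> P\<^sub>i'(c\<^sub>i) dc\<^sub>i - \<Sum> c\<^sub>2\<^sub>j dc\<^sub>2\<^sub>j\<^sub>+\<^sub>1\<close>. It is a contact form for every choice of the \<open>P\<^sub>i\<close>, and its
  horizontal disks are the disks with \<open>z' = \<Sum> c\<^sub>2\<^sub>j c\<^sub>2\<^sub>j\<^sub>+\<^sub>1'\<close> that avoid the graph of \<open>E\<close>, together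
  with a logarithm \<open>w\<close> of \<open>z - E(c)\<close>.

  The point is to choose \<open>E\<close> so that its graph is an obstacle to all large horizontal disks. Take
  \<open>E(c) = \<Sum> (c\<^sub>k\<^sub>mod\<^sub>2\<^sub>n / b\<^sub>k)\<^sup>d\<close>, summed over all \<open>k \<ge> 0\<close>, with \<open>b\<^sub>k = 2 k + 2\<close> and
  exponents \<open>d = d\<^sub>k\<close> that grow fast enough. Suppose that on some disk the higher terms are already known to be small.
  Then all coordinates are bounded, so by Cauchy's estimate \<open>z'\<close> and hence \<open>z\<close> are bounded on a
  slightly smaller disk, by a number that depends only on \<open>k\<close> and on the exponents before \<open>d\<^sub>k\<close>. Thus \<open>e\<^sup>w\<close> differs from
  \<open>- (c\<^sub>k\<^sub>mod\<^sub>2\<^sub>n / b\<^sub>k)\<^sup>d\<close> by a bounded amount, and it has no zeros. If \<open>d\<close> is large enough, this is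
  possible only if \<open>\<bar>c\<^sub>k\<^sub>mod\<^sub>2\<^sub>n\<bar>\<close> remains below \<open>b\<^sub>k\<close> (lemma \<open>zero_free_perturbed_power\<close>): otherwise
  the \<open>d\<close>-th root of \<open>e\<^sup>w\<close> would be a function that has modulus nearly one where \<open>\<bar>c\<^sub>k\<^sub>mod\<^sub>2\<^sub>n\<bar> < b\<^sub>k\<close>
  but not elsewhere. So the \<open>k\<close>-th term is small as well.

  Iterating this downwards from a level that depends on the disk, until the level is comparable to
  the centre of the disk, one obtains a bound for the coordinates on half the disk in terms of
  the centre alone (\<open>horizontal_disk_coordinate_bound\<close>). The derivatives of horizontal disks at
  their centres are therefore locally uniformly bounded, the directed norm is locally bounded below by a
  multiple of the Euclidean norm, and distinct points have positive distance
  (\<open>kobayashi_hyperbolic_if_disks_bounded\<close>).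
\<close>

section \<open>Zero-free perturbations of a high power\<close>

lemma le_powr_inverse:
  fixes x y :: real
  assumes "x ^ d \<le> y" "0 \<le> x" "d > 0"
  shows "x \<le> y powr (1 / real d)"
proof -
  have "x = (x ^ d) powr (1 / real d)"
    using assms by (cases "x = 0") (auto simp: powr_realpow[symmetric] powr_powr)
  also have "\<dots> \<le> y powr (1 / real d)"
    using assms by (intro powr_mono2) auto
  finally show ?thesis .
qed

text \<open>
  Why the exponent can be chosen before the functions: let \<open>c\<close> and \<open>w\<close> vary with \<open>d \<rightarrow> \<infinity>\<close> and
  put \<open>Q = exp (w / d)\<close>, so that \<open>Q\<^sup>d + c\<^sup>d\<close> stays bounded. By Montel's theorem \<open>c\<close> and \<open>Q\<close>
  converge along a subsequence. Near \<open>0\<close> we have \<open>\<bar>c\<bar> < 1\<close>, hence \<open>\<bar>Q\<bar> \<le> 1\<close> in the limit, and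
  \<open>\<bar>Q 0\<bar> = 1\<close> in the limit because \<open>w 0\<close> is bounded. So the limit of \<open>Q\<close> is a constant of modulus
  one by the maximum principle, and \<open>\<bar>c\<bar>\<close> cannot exceed \<open>1\<close> in the limit, anywhere on the disk.
  Since \<open>\<bar>c 0\<bar> \<le> 1 / 2\<close>, the limit of \<open>c\<close> even stays away from the unit circle on the smaller
  disk, and then \<open>c\<^sup>d\<close> tends to zero there. The existence of the logarithm \<open>w\<close>, that is, the
  absence of zeros, is what makes \<open>Q\<close> available.
\<close>

lemma zero_free_perturbed_power:
  fixes \<rho> \<rho>' S B R \<epsilon> :: real and m :: nat
  assumes "0 \<le> \<rho>" "\<rho> < \<rho>'" "\<epsilon> > 0"
  shows "\<exists>d\<ge>m. \<forall>c w. c holomorphic_on ball 0 \<rho>' \<and> w holomorphic_on ball 0 \<rho>' \<and>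
           (\<forall>t\<in>ball 0 \<rho>'. cmod (c t) \<le> S \<and> cmod (exp (w t) + c t ^ d) \<le> B) \<and>
           cmod (c 0) \<le> 1 / 2 \<and> cmod (w 0) \<le> R \<longrightarrow>
           (\<forall>t\<in>cball 0 \<rho>. cmod (c t) ^ d \<le> \<epsilon>)"
proof (rule ccontr)
  assume contr: "\<not> ?thesis"
  define U where "U = ball (0::complex) \<rho>'"
  have U: "open U" "connected U" "0 \<in> U" "cball 0 \<rho> \<subseteq> U"
    using assms by (auto simp: U_def)
  define D where "D k = Suc (m + k)" for k :: nat
  have "\<exists>c w t. c holomorphic_on U \<and> w holomorphic_on U \<and>
           (\<forall>t\<in>U. cmod (c t) \<le> S \<and> cmod (exp (w t) + c t ^ D k) \<le> B) \<and>
           cmod (c 0) \<le> 1 / 2 \<and> cmod (w 0) \<le> R \<and> t \<in> cball 0 \<rho> \<and> cmod (c t) ^ D k > \<epsilon>" for k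
  proof -
    have "D k \<ge> m" by (simp add: D_def)
    with contr show ?thesis unfolding U_def not_le[symmetric] by blast
  qed
  then obtain C W T where C: "\<And>k. C k holomorphic_on U" and W: "\<And>k. W k holomorphic_on U"
    and CS: "\<And>k t. t \<in> U \<Longrightarrow> cmod (C k t) \<le> S"
    and WB: "\<And>k t. t \<in> U \<Longrightarrow> cmod (exp (W k t) + C k t ^ D k) \<le> B"
    and C0: "\<And>k. cmod (C k 0) \<le> 1 / 2" and W0: "\<And>k. cmod (W k 0) \<le> R"
    and T: "\<And>k. T k \<in> cball 0 \<rho>" "\<And>k. cmod (C k (T k)) ^ D k > \<epsilon>"
    by metis
  have S0: "S \<ge> 0" using CS[OF U(3), of 0] norm_ge_zero order_trans by blast
  have B0: "B \<ge> 0" using WB[OF U(3), of 0] norm_ge_zero order_trans by blast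
  have D0: "D k > 0" for k by (simp add: D_def)
  define Q where "Q = (\<lambda>k t. exp (W k t / of_nat (D k)))"
  have Qhol: "Q k holomorphic_on U" for k
    unfolding Q_def using D0[of k] by (intro holomorphic_intros W) auto
  have Qpow: "cmod (Q k t) ^ D k = cmod (exp (W k t))" for k t
  proof -
    have "Q k t ^ D k = exp (W k t)"
      unfolding Q_def using D0[of k] by (simp add: exp_of_nat_mult[symmetric])
    then show ?thesis by (metis norm_power)
  qed
  have Qle: "cmod (Q k t) ^ D k \<le> B + cmod (C k t) ^ D k" if "t \<in> U" for k t
  proof -
    have "cmod (exp (W k t)) \<le> cmod (exp (W k t) + C k t ^ D k) + cmod (C k t ^ D k)"
      using norm_triangle_ineq4[of "exp (W k t) + C k t ^ D k" "C k t ^ D k"] by simp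
    then show ?thesis using WB[OF that, of k] by (simp add: Qpow norm_power)
  qed
  have Cle: "cmod (C k t) ^ D k \<le> B + cmod (Q k t) ^ D k" if "t \<in> U" for k t
  proof -
    have "cmod (C k t ^ D k) \<le> cmod (exp (W k t) + C k t ^ D k) + cmod (exp (W k t))"
      using norm_triangle_ineq4[of "exp (W k t) + C k t ^ D k" "exp (W k t)"] by simp
    then show ?thesis using WB[OF that, of k] by (simp add: Qpow norm_power)
  qed
  have QK: "cmod (Q k t) \<le> (B + 1) * (S + 1)" if "t \<in> U" for k t
  proof (rule power_le_imp_le_base)
    have "cmod (Q k t) ^ D k \<le> B + S ^ D k"
      using Qle[OF that, of k] power_mono[OF CS[OF that, of k], of "D k"] by simp
    also have "\<dots> \<le> B * (S + 1) ^ D k + (S + 1) ^ D k"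
      using S0 B0 one_le_power[of "S + 1" "D k"]
      by (intro add_mono power_mono) (auto simp: mult_le_cancel_left1)
    also have "\<dots> = (B + 1) * (S + 1) ^ D k"
      by (simp add: algebra_simps)
    also have "\<dots> \<le> (B + 1) ^ D k * (S + 1) ^ D k"
      using self_le_power[of "B + 1" "D k"] B0 S0 D0[of k] by (intro mult_right_mono) auto
    finally show "cmod (Q k t) ^ Suc (m + k) \<le> ((B + 1) * (S + 1)) ^ Suc (m + k)"
      by (simp only: D_def power_mult_distrib)
  qed (use S0 B0 in auto)
  obtain c r1 where c: "c holomorphic_on U" "strict_mono r1"
      "\<And>x. x \<in> U \<Longrightarrow> (\<lambda>n. C (r1 n) x) \<longlonglongrightarrow> c x"
      "\<And>K. compact K \<Longrightarrow> K \<subseteq> U \<Longrightarrow> uniform_limit K (C \<circ> r1) c sequentially"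
    by (rule Montel[OF U(1), of "{h. h holomorphic_on U \<and> (\<forall>t\<in>U. cmod (h t) \<le> S)}" C])
       (use C CS in blast)+
  obtain q r2 where q: "q holomorphic_on U" "strict_mono r2"
      "\<And>x. x \<in> U \<Longrightarrow> (\<lambda>n. Q (r1 (r2 n)) x) \<longlonglongrightarrow> q x"
  proof (rule Montel[OF U(1), of "{h. h holomorphic_on U \<and> (\<forall>t\<in>U. cmod (h t) \<le> (B + 1) * (S + 1))}" "\<lambda>n. Q (r1 n)"])
    show "range (\<lambda>n. Q (r1 n)) \<subseteq> {h. h holomorphic_on U \<and> (\<forall>t\<in>U. cmod (h t) \<le> (B + 1) * (S + 1))}"
      using QK Qhol by auto
  qed blast+
  define r where "r = r1 \<circ> r2"
  have r: "strict_mono r" using c(2) q(2) by (auto simp: r_def strict_mono_def)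
  have climit: "(\<lambda>n. C (r n) x) \<longlonglongrightarrow> c x" if "x \<in> U" for x
    using LIMSEQ_subseq_LIMSEQ[OF c(3)[OF that] q(2)] by (simp add: r_def o_def)
  have qlimit: "(\<lambda>n. Q (r n) x) \<longlonglongrightarrow> q x" if "x \<in> U" for x
    using q(3)[OF that] by (simp add: r_def)
  have Dnat: "filterlim (\<lambda>n. D (r n)) at_top sequentially"
    unfolding D_def
    by (rule filterlim_at_top_mono[OF filterlim_subseq[OF r]]) (auto intro!: always_eventually)
  have Dlim: "filterlim (\<lambda>n. real (D (r n))) at_top sequentially"
    using filterlim_compose[OF filterlim_real_sequentially Dnat] .
  then have inv0: "(\<lambda>n. 1 / real (D (r n))) \<longlonglongrightarrow> 0"
    by (intro tendsto_divide_0[OF tendsto_const] filterlim_at_top_imp_at_infinity)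
  have root1: "(\<lambda>n. (B + 1) powr (1 / real (D (r n)))) \<longlonglongrightarrow> 1"
    using tendsto_powr[OF tendsto_const[of "B + 1"] inv0] B0 by simp
  \<comment> \<open>The limit of the roots has modulus at most one near 0 and equal to one at 0.\<close>
  have c0: "cmod (c 0) \<le> 1 / 2"
    using C0 by (intro tendsto_upperbound[OF tendsto_norm[OF climit[OF U(3)]]]) auto
  have "continuous_on U (\<lambda>x. cmod (c x))"
    using c(1) holomorphic_on_imp_continuous_on by (intro continuous_intros) blast
  then have "open (U \<inter> (\<lambda>x. cmod (c x)) -` {..<1})"
    using U(1) by (intro continuous_open_preimage) auto
  then obtain V where V: "open V" "0 \<in> V" "V \<subseteq> U" "\<And>x. x \<in> V \<Longrightarrow> cmod (c x) < 1"
    using U(3) c0 by (intro that[of "U \<inter> (\<lambda>x. cmod (c x)) -` {..<1}"]) auto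
  have qV: "cmod (q x) \<le> 1" if x: "x \<in> V" for x
  proof (rule tendsto_le[OF _ root1 tendsto_norm[OF qlimit]])
    have xU: "x \<in> U" using V x by blast
    have "eventually (\<lambda>n. cmod (C (r n) x) < 1) sequentially"
      using order_tendstoD(2)[OF tendsto_norm[OF climit[OF xU]] V(4)[OF x]] .
    then show "\<forall>\<^sub>F n in sequentially. cmod (Q (r n) x) \<le> (B + 1) powr (1 / real (D (r n)))"
    proof eventually_elim
      case (elim n)
      show ?case
        using Qle[OF xU, of "r n"] power_le_one[of "cmod (C (r n) x)" "D (r n)"] elim D0
        by (intro le_powr_inverse) auto
    qed
  qed (use V x in auto)
  have q0: "cmod (q 0) = 1"
  proof (rule LIMSEQ_unique[OF tendsto_norm[OF qlimit[OF U(3)]]])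
    have "(\<lambda>n. Re (W (r n) 0) / real (D (r n))) \<longlonglongrightarrow> 0"
    proof (rule Lim_null_comparison)
      show "(\<lambda>n. R * (1 / real (D (r n)))) \<longlonglongrightarrow> 0"
        using tendsto_mult_right_zero[OF inv0] by blast
      show "\<forall>\<^sub>F n in sequentially. norm (Re (W (r n) 0) / real (D (r n))) \<le> R * (1 / real (D (r n)))"
        using order_trans[OF abs_Re_le_cmod W0]
        by (intro always_eventually allI) (simp add: divide_right_mono)
    qed
    from tendsto_exp[OF this] show "(\<lambda>n. cmod (Q (r n) 0)) \<longlonglongrightarrow> 1"
      by (simp add: Q_def)
  qed
  have "q constant_on U"
    using q0 qV by (intro maximum_modulus_principle[OF q(1) U(1,2) V(1,3,2)]) auto
  then have q1: "cmod (q x) = 1" if "x \<in> U" for x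
    using that q0 U(3) by (metis constant_on_def)
  \<comment> \<open>Conversely the power of \<open>c\<close> is now controlled by the power of \<open>Q\<close>.\<close>
  have c1: "cmod (c x) \<le> 1" if x: "x \<in> U" for x
  proof (rule tendsto_le[OF _ _ tendsto_norm[OF climit[OF x]]])
    have "(\<lambda>n. (B + 1) powr (1 / real (D (r n))) * max 1 (cmod (Q (r n) x))) \<longlonglongrightarrow> 1 * max 1 (cmod (q x))"
      by (intro tendsto_intros root1 qlimit x)
    then show "(\<lambda>n. (B + 1) powr (1 / real (D (r n))) * max 1 (cmod (Q (r n) x))) \<longlonglongrightarrow> 1"
      using q1[OF x] by simp
    show "\<forall>\<^sub>F n in sequentially. cmod (C (r n) x) \<le>
            (B + 1) powr (1 / real (D (r n))) * max 1 (cmod (Q (r n) x))"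
    proof (intro always_eventually allI)
      fix n
      define M where "M = max 1 (cmod (Q (r n) x))"
      have M: "M \<ge> 1" "cmod (Q (r n) x) \<le> M" by (auto simp: M_def)
      have "cmod (C (r n) x) ^ D (r n) \<le> B * M ^ D (r n) + M ^ D (r n)"
        using Cle[OF x, of "r n"] mult_left_mono[OF one_le_power[OF M(1), of "D (r n)"] B0]
          power_mono[OF M(2), of "D (r n)"] by simp
      then have "(cmod (C (r n) x) / M) ^ D (r n) \<le> B + 1"
        using M(1) by (simp add: power_divide divide_le_eq algebra_simps)
      then have "cmod (C (r n) x) / M \<le> (B + 1) powr (1 / real (D (r n)))"
        using M(1) D0 by (intro le_powr_inverse) auto
      then show "cmod (C (r n) x) \<le> (B + 1) powr (1 / real (D (r n))) * max 1 (cmod (Q (r n) x))"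
        using M(1) by (simp add: divide_le_eq M_def)
    qed
  qed auto
  \<comment> \<open>A limit that reaches the unit circle would be constant, against its value at 0.\<close>
  have clt: "cmod (c x) < 1" if x: "x \<in> U" for x
  proof (rule ccontr)
    assume "\<not> cmod (c x) < 1"
    then have "cmod (c x) = 1" using c1[OF x] by simp
    then have "c constant_on U"
      using c1 by (intro maximum_modulus_principle[OF c(1) U(1,2) U(1) order_refl x]) auto
    with c0 \<open>cmod (c x) = 1\<close> x U(3) show False by (auto simp: constant_on_def)
  qed
  have "continuous_on (cball 0 \<rho>) (\<lambda>x. cmod (c x))"
    using c(1) U(4) holomorphic_on_imp_continuous_on holomorphic_on_subset
    by (intro continuous_intros) blast
  then obtain x0 where x0: "x0 \<in> cball 0 \<rho>" "\<And>x. x \<in> cball 0 \<rho> \<Longrightarrow> cmod (c x) \<le> cmod (c x0)"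
    using continuous_attains_sup[of "cball 0 \<rho>" "\<lambda>x. cmod (c x)"] assms(1) by auto
  define \<theta> where "\<theta> = (1 + cmod (c x0)) / 2"
  have \<theta>: "cmod (c x0) < \<theta>" "\<theta> < 1" "0 \<le> \<theta>"
    using clt[of x0] x0(1) U(4) by (auto simp: \<theta>_def)
  have "uniform_limit (cball 0 \<rho>) (C \<circ> r1) c sequentially"
    using c(4) U(4) by simp
  then have "eventually (\<lambda>n. \<forall>x\<in>cball 0 \<rho>. dist (C (r1 n) x) (c x) < \<theta> - cmod (c x0)) sequentially"
    using \<theta>(1) unfolding uniform_limit_iff by simp
  then have "eventually (\<lambda>n. \<forall>x\<in>cball 0 \<rho>. dist (C (r n) x) (c x) < \<theta> - cmod (c x0)) sequentially"
    unfolding r_def o_def using eventually_subseq[OF q(2)] by blast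
  moreover have "eventually (\<lambda>n. \<theta> ^ D (r n) < \<epsilon>) sequentially"
    using order_tendstoD(2)[OF filterlim_compose[OF LIMSEQ_power_zero[of \<theta>] Dnat] assms(3)] \<theta> by simp
  ultimately have "eventually (\<lambda>n::nat. False) sequentially"
  proof eventually_elim
    case (elim n)
    have "cmod (C (r n) (T (r n))) \<le> \<theta>"
      using elim(1) T(1)[of "r n"] x0(2)[OF T(1)[of "r n"]] norm_triangle_ineq2[of "C (r n) (T (r n))" "c (T (r n))"]
      by (fastforce simp: dist_norm)
    then have "cmod (C (r n) (T (r n))) ^ D (r n) \<le> \<theta> ^ D (r n)" by (intro power_mono) auto
    then show False using T(2)[of "r n"] elim(2) by simp
  qed
  then show False by simp
qed

section \<open>The barrier function\<close>

text \<open>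
  The \<open>k\<close>-th term of the barrier function is \<open>(u / b\<^sub>k)\<^sup>d\<close>, where \<open>b\<^sub>k\<close> is the threshold and \<open>d\<close> the
  \<open>k\<close>-th exponent. A point of norm at most \<open>m\<close> satisfies \<open>\<bar>u\<bar> \<le> b\<^sub>k / 2\<close> for all \<open>k \<ge> m\<close>.
\<close>

definition threshold :: "nat \<Rightarrow> real" where
  "threshold k = 2 * real k + 2"

text \<open>
  Each descent from level \<open>m + 1\<close> to level \<open>m\<close> costs a little of the disk, twice: the passage to
  the middle radius pays for a Cauchy estimate, the passage to the radius of level \<open>m\<close> for the
  compactness argument. All radii stay between \<open>1 / 2\<close> and \<open>3 / 4\<close>.
\<close>

definition radius :: "nat \<Rightarrow> real" where
  "radius m = 3 / 4 - 1 / (4 * (real m + 1))"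

definition middle_radius :: "nat \<Rightarrow> real" where
  "middle_radius m = (radius m + radius (Suc m)) / 2"

text \<open>
  A bound for all coordinates at level \<open>m + 1\<close>: among the indices from \<open>m + 1\<close> up to
  \<open>(m + 2) * 2 n\<close> every residue class modulo \<open>2 n\<close> occurs.
\<close>

definition amplitude :: "nat \<Rightarrow> nat \<Rightarrow> real" where
  "amplitude n m = threshold ((m + 2) * (2 * n))"

definition lower_terms_bound :: "nat \<Rightarrow> (nat \<Rightarrow> nat) \<Rightarrow> nat \<Rightarrow> real" where
  "lower_terms_bound n d m = (\<Sum>k<m. (amplitude n m / threshold k) ^ d k)"

text \<open>
  A bound for everything in \<open>z - E\<close> except the \<open>m\<close>-th term of \<open>E\<close>: the last summand bounds the
  variation of \<open>z\<close>, the lower terms of \<open>E\<close> enter once for \<open>z 0\<close> and once for \<open>E\<close> itself, and the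
  constant absorbs the higher terms and the \<open>m\<close>-th term at the centre. Only the exponents below \<open>m\<close> occur in it, so that
  the \<open>m\<close>-th exponent may depend on it.
\<close>

definition remainder_bound :: "nat \<Rightarrow> (nat \<Rightarrow> nat) \<Rightarrow> nat \<Rightarrow> real" where
  "remainder_bound n d m = exp (real m) + 2 * lower_terms_bound n d m + 5
     + real n * (amplitude n m * (amplitude n m / (radius (Suc m) - middle_radius m)))"

text \<open>
  What the \<open>m\<close>-th exponent has to achieve in the descent from level \<open>m + 1\<close> to level \<open>m\<close>.
\<close>

definition admissible_exponent :: "nat \<Rightarrow> (nat \<Rightarrow> nat) \<Rightarrow> nat \<Rightarrow> nat \<Rightarrow> bool" where
  "admissible_exponent n d m r \<longleftrightarrow> (\<forall>c w.
     c holomorphic_on ball 0 (middle_radius m) \<and> w holomorphic_on ball 0 (middle_radius m) \<and>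
     (\<forall>t\<in>ball 0 (middle_radius m). cmod (c t) \<le> amplitude n m / threshold m \<and>
        cmod (exp (w t) + c t ^ r) \<le> remainder_bound n d m) \<and>
     cmod (c 0) \<le> 1 / 2 \<and> cmod (w 0) \<le> real m \<longrightarrow>
     (\<forall>t\<in>cball 0 (radius m). cmod (c t) ^ r \<le> (1 / 2) ^ m))"

lemma threshold_pos: "threshold k > 0" "threshold k \<noteq> 0" and threshold_mono: "j \<le> k \<Longrightarrow> threshold j \<le> threshold k"
  by (auto simp: threshold_def)

lemma radius_less: "radius m < middle_radius m" "middle_radius m < radius (Suc m)"
proof -
  have "radius m < radius (Suc m)"
    unfolding radius_def by (intro diff_strict_left_mono divide_strict_left_mono) auto
  then show "radius m < middle_radius m" "middle_radius m < radius (Suc m)"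
    by (auto simp: middle_radius_def)
qed

lemma radius_bounds: "1 / 2 \<le> radius m" "radius m < 3 / 4" "middle_radius m < 3 / 4"
proof -
  show "1 / 2 \<le> radius m" by (simp add: radius_def field_simps)
  show lt: "radius m < 3 / 4" for m by (simp add: radius_def)
  show "middle_radius m < 3 / 4" using radius_less(2)[of m] lt[of "Suc m"] by simp
qed

lemma exponents_exist:
  obtains d where "\<And>m. Suc m \<le> d m" "\<And>m. admissible_exponent n d m (d m)"
proof -
  have "\<exists>d. \<forall>m. Suc m \<le> d m \<and> admissible_exponent n d m (d m)"
  proof (rule dependent_wellorder_choice)
    fix r and f g :: "nat \<Rightarrow> nat" and m :: nat
    assume "\<And>k. k < m \<Longrightarrow> f k = g k"
    then have "lower_terms_bound n f m = lower_terms_bound n g m"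
      by (simp add: lower_terms_bound_def)
    then show "(Suc m \<le> r \<and> admissible_exponent n f m r) = (Suc m \<le> r \<and> admissible_exponent n g m r)"
      by (simp add: admissible_exponent_def remainder_bound_def)
  next
    fix m and d :: "nat \<Rightarrow> nat"
    have "0 \<le> radius m" using radius_bounds(1)[of m] by simp
    from zero_free_perturbed_power[OF this radius_less(1), of "(1 / 2) ^ m" "Suc m"]
    show "\<exists>r. Suc m \<le> r \<and> admissible_exponent n d m r"
      unfolding admissible_exponent_def by simp
  qed
  with that show ?thesis by blast
qed

definition lacunary_potential :: "nat \<Rightarrow> (nat \<Rightarrow> nat) \<Rightarrow> nat \<Rightarrow> complex \<Rightarrow> complex" where
  "lacunary_potential L d i u =
     (\<Sum>k. if k mod L = i then (u / of_real (threshold k)) ^ d k else 0)"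

lemma lacunary_potential:
  assumes "\<And>k. k \<le> d k"
  shows "(\<lambda>k. if k mod L = i then (u / of_real (threshold k)) ^ d k else 0) sums lacunary_potential L d i u"
    and "lacunary_potential L d i holomorphic_on UNIV"
proof -
  let ?f = "\<lambda>k u. if k mod L = i then (u / of_real (threshold k)) ^ d k else (0::complex)"
  have "\<exists>g g'. \<forall>u\<in>UNIV. (\<lambda>k. ?f k u) sums g u \<and> (\<lambda>k. deriv (?f k) u) sums g' u \<and> (g has_field_derivative g' u) (at u)"
  proof (rule series_and_derivative_comparison_local)
    fix k u
    show "(?f k has_field_derivative deriv (?f k) u) (at u)"
      by (rule holomorphic_derivI[of _ UNIV], cases "k mod L = i")
         (auto intro!: holomorphic_intros simp: threshold_pos)
  next
    fix u :: complex
    have "\<forall>\<^sub>F k in sequentially. \<forall>y\<in>ball u 1 \<inter> UNIV. cmod (?f k y) \<le> (1 / 2) ^ k"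
    proof (rule eventually_sequentiallyI[of "nat \<lceil>cmod u\<rceil>"], intro ballI)
      fix k y assume k: "k \<ge> nat \<lceil>cmod u\<rceil>" and y: "y \<in> ball u 1 \<inter> UNIV"
      have "cmod y \<le> cmod u + 1" using y norm_triangle_sub[of y u] by (simp add: dist_norm norm_minus_commute)
      also have "\<dots> \<le> threshold k / 2" using k by (simp add: threshold_def)
      finally have "cmod (y / of_real (threshold k)) \<le> 1 / 2"
        using threshold_pos[of k] by (simp add: norm_divide field_simps)
      then have "cmod (y / of_real (threshold k)) ^ d k \<le> (1 / 2) ^ d k" by (intro power_mono) auto
      also have "\<dots> \<le> (1 / 2) ^ k" using assms by (intro power_decreasing) auto
      finally show "cmod (?f k y) \<le> (1 / 2) ^ k" by (simp add: norm_power)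
    qed
    then show "\<exists>\<delta> h. 0 < \<delta> \<and> summable h \<and> (\<forall>\<^sub>F k in sequentially. \<forall>y\<in>ball u \<delta> \<inter> UNIV. cmod (?f k y) \<le> h k)"
      by (intro exI[of _ 1] exI[of _ "\<lambda>k. (1 / 2) ^ k"]) (auto intro: summable_geometric)
  qed auto
  then obtain g where g: "\<And>u. (\<lambda>k. ?f k u) sums g u" "\<And>u. g field_differentiable (at u)"
    unfolding field_differentiable_def by blast
  have eq: "lacunary_potential L d i = g"
    unfolding lacunary_potential_def by (rule ext) (rule sums_unique[OF g(1), symmetric])
  show "(\<lambda>k. ?f k u) sums lacunary_potential L d i u"
    unfolding eq by (rule g(1))
  show "lacunary_potential L d i holomorphic_on UNIV"
    unfolding eq holomorphic_on_def by (simp add: g(2))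
qed

section \<open>Bounds for horizontal disks\<close>

text \<open>
  This isolates one term of the barrier function; the constant is the sum of the geometric series.
\<close>

lemma sums_minus_term_bound:
  fixes f :: "nat \<Rightarrow> complex"
  assumes "f sums s" "\<And>k. k < m \<Longrightarrow> cmod (f k) \<le> a k" "\<And>k. k > m \<Longrightarrow> cmod (f k) \<le> (1 / 2) ^ k"
  shows "cmod (s - f m) \<le> (\<Sum>k<m. a k) + 2"
proof (rule norm_sums_le)
  show "(\<lambda>k. f k - (if k = m then f k else 0)) sums (s - f m)"
    by (intro sums_diff assms sums_single)
  have "(\<lambda>k. (if k \<in> {..<m} then a k else 0) + (1 / 2 :: real) ^ k) sums ((\<Sum>k<m. a k) + 1 / (1 - 1 / 2))"
    by (intro sums_add sums_If_finite_set geometric_sums) auto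
  then show "(\<lambda>k. (if k \<in> {..<m} then a k else 0) + (1 / 2 :: real) ^ k) sums ((\<Sum>k<m. a k) + 2)"
    by simp
  fix k show "cmod (f k - (if k = m then f k else 0)) \<le> (if k \<in> {..<m} then a k else 0) + (1 / 2 :: real) ^ k"
    using assms(2)[of k] assms(3)[of k] by (cases k m rule: linorder_cases) (auto simp: add_increasing2)
qed

lemma norm_deriv_le:
  assumes "f holomorphic_on S" "cball t \<delta> \<subseteq> S" "\<delta> > 0" "\<And>x. x \<in> cball t \<delta> \<Longrightarrow> cmod (f x) \<le> B"
  shows "cmod (deriv f t) \<le> B / \<delta>"
proof -
  have hol: "f holomorphic_on cball t \<delta>"
    by (rule holomorphic_on_subset[OF assms(1,2)])
  have "cmod ((deriv ^^ 1) f t) \<le> fact 1 * B / \<delta> ^ 1"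
  proof (rule Cauchy_inequality)
    show "f holomorphic_on ball t \<delta>" by (rule holomorphic_on_subset[OF hol ball_subset_cball])
    show "continuous_on (cball t \<delta>) f" by (rule holomorphic_on_imp_continuous_on[OF hol])
    show "cmod (f x) \<le> B" if "norm (t - x) = \<delta>" for x using that by (intro assms(4)) (simp add: dist_norm)
  qed (rule assms(3))
  then show ?thesis by simp
qed

text \<open>
  The index \<open>m * L + i\<close> is at least \<open>m\<close> and belongs to the coordinate \<open>i\<close>.
\<close>

lemma coordinate_bound:
  assumes "\<And>k t. m \<le> k \<Longrightarrow> t \<in> cball 0 (radius m) \<Longrightarrow> cmod (c (k mod L) t / of_real (threshold k)) ^ d k \<le> (1 / 2) ^ k"
    and "\<And>k. Suc k \<le> d k" "i < L" "t \<in> cball 0 (radius m)"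
  shows "cmod (c i t) \<le> threshold ((m + 1) * L)"
proof -
  let ?k = "m * L + i"
  have "m \<le> ?k" using assms(3) by (simp add: trans_le_add1)
  with assms(1)[OF this assms(4)] have "cmod (c i t / of_real (threshold ?k)) ^ d ?k \<le> (1 / 2) ^ ?k"
    using assms(3) by simp
  also have "\<dots> \<le> 1" by (intro power_le_one) auto
  finally have "cmod (c i t / of_real (threshold ?k)) \<le> 1"
    using assms(2)[of ?k] by (subst (asm) power_le_one_iff) auto
  then have "cmod (c i t) \<le> threshold ?k" using threshold_pos[of ?k] by (simp add: norm_divide)
  also have "\<dots> \<le> threshold ((m + 1) * L)" using assms(3) by (intro threshold_mono) simp
  finally show ?thesis .
qed

text \<open>
  The descent over the levels. Level \<open>M\<close> asserts that all terms of \<open>E\<close> from the \<open>M\<close>-th on are tiny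
  on the disk of radius \<open>radius M\<close>. Some level is reached by each disk, because the coordinates
  are bounded on a compact disk while the thresholds tend to infinity; this level depends on the
  disk. The step down to \<open>M\<close> does not, and it works as long as the centre lies below the
  threshold: at level \<open>M + 1\<close> the coordinates are bounded by the amplitude, hence so is the
  derivative of \<open>z = e\<^sup>w + E\<close>, hence \<open>z\<close> itself; then \<open>e\<^sup>w\<close> plus the \<open>M\<close>-th term of \<open>E\<close> is bounded
  and the choice of the \<open>M\<close>-th exponent applies. The descent ends at the level given by the size
  of the centre.
\<close>

lemma horizontal_disk_coordinate_bound:
  fixes c :: "nat \<Rightarrow> complex \<Rightarrow> complex" and w :: "complex \<Rightarrow> complex"
  assumes n: "n > 0"
    and d: "\<And>m. Suc m \<le> d m" "\<And>m. admissible_exponent n d m (d m)"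
    and P: "\<And>i u. (\<lambda>k. if k mod (2 * n) = i then (u / of_real (threshold k)) ^ d k else 0) sums P i u"
      "\<And>i u. (P i has_field_derivative P' i u) (at u)"
    and hol: "\<And>i. i < 2 * n \<Longrightarrow> c i holomorphic_on ball 0 1" "w holomorphic_on ball 0 1"
    and eq: "\<And>t. t \<in> ball 0 1 \<Longrightarrow> exp (w t) * deriv w t + (\<Sum>i<2 * n. P' i (c i t) * deriv (c i) t)
               = (\<Sum>j<n. c (2 * j) t * deriv (c (2 * j + 1)) t)"
    and init: "\<And>i. i < 2 * n \<Longrightarrow> cmod (c i 0) \<le> real m" "cmod (w 0) \<le> real m"
    and it: "i < 2 * n" "t \<in> cball 0 (1 / 2)"
  shows "cmod (c i t) \<le> amplitude n m"
proof -
  define L where "L = 2 * n"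
  have L: "L > 0" using n by (simp add: L_def)
  define f where "f k t = (c (k mod L) t / of_real (threshold k)) ^ d k" for k t
  define E where "E t = (\<Sum>i<L. P i (c i t))" for t
  define small where "small m \<longleftrightarrow> (\<forall>k\<ge>m. \<forall>t\<in>cball 0 (radius m). cmod (f k t) \<le> (1 / 2) ^ k)" for m
  have fE: "(\<lambda>k. f k t) sums E t" for t
  proof -
    have "(\<lambda>k. \<Sum>i<L. if k mod L = i then (c i t / of_real (threshold k)) ^ d k else 0) sums E t"
      unfolding E_def by (intro sums_sum) (use P(1) in \<open>simp add: L_def\<close>)
    moreover have "(\<Sum>i<L. if k mod L = i then (c i t / of_real (threshold k)) ^ d k else 0) = f k t" for k
      using L by (simp add: f_def sum.delta')
    ultimately show ?thesis by simp
  qed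
  have bound: "cmod (c i t) \<le> threshold ((m + 1) * L)" if "small m" "i < L" "t \<in> cball 0 (radius m)" for m i t
    using coordinate_bound[of m c L d i t] that d(1) by (simp add: small_def f_def norm_power)
  have c': "(c i has_field_derivative deriv (c i) t) (at t)" if "i < L" "t \<in> ball 0 1" for i t
    using holomorphic_derivI[OF hol(1)] that by (auto simp: L_def)
  have w': "(w has_field_derivative deriv w t) (at t)" if "t \<in> ball 0 1" for t
    using holomorphic_derivI[OF hol(2)] that by auto
  define z where "z t = exp (w t) + E t" for t
  have z': "(z has_field_derivative (\<Sum>j<n. c (2 * j) t * deriv (c (2 * j + 1)) t)) (at t)" if t: "t \<in> ball 0 1" for t
  proof -
    have "(z has_field_derivative exp (w t) * deriv w t + (\<Sum>i<L. P' i (c i t) * deriv (c i) t)) (at t)"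
      unfolding z_def E_def
      by (intro DERIV_add DERIV_sum DERIV_chain2[OF DERIV_exp] DERIV_chain2[OF P(2)] w' c' t) auto
    then show ?thesis using eq[OF t] by (simp add: L_def)
  qed
  have step: "small M" if M: "m \<le> M" "small (Suc M)" for M
  proof -
    define A where "A = amplitude n M"
    have A0: "A > 0" by (simp add: A_def amplitude_def threshold_pos)
    have cA: "cmod (c i t) \<le> A" if "i < L" "t \<in> cball 0 (radius (Suc M))" for i t
      using bound[OF M(2) that] by (simp add: A_def amplitude_def L_def)
    have init': "cmod (c i 0) \<le> threshold M / 2" if "i < L" for i
      using init(1)[of i] that M(1) by (simp add: L_def threshold_def)
    have rest: "cmod (E t - f M t) \<le> lower_terms_bound n d M + 2" if t: "t \<in> cball 0 (radius (Suc M))" for t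
      unfolding lower_terms_bound_def
    proof (rule sums_minus_term_bound[OF fE])
      fix k assume "k < M"
      show "cmod (f k t) \<le> (amplitude n M / threshold k) ^ d k"
        unfolding f_def norm_power norm_divide
        using cA[of "k mod L", OF _ t] L threshold_pos[of k] by (intro power_mono) (auto simp: A_def intro!: divide_right_mono)
    next
      fix k assume "k > M"
      then show "cmod (f k t) \<le> (1 / 2) ^ k" using M(2) t by (simp add: small_def)
    qed
    have f0: "cmod (c (M mod L) 0 / of_real (threshold M)) \<le> 1 / 2"
      using init'[of "M mod L"] L threshold_pos[of M] by (simp add: norm_divide field_simps)
    have z0: "cmod (z 0) \<le> exp (real M) + lower_terms_bound n d M + 3"
    proof -
      have "cmod (f M 0) \<le> 1" unfolding f_def norm_power by (rule power_le_one) (use f0 in auto)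
      moreover have "cmod (exp (w 0)) \<le> exp (real M)"
        using norm_exp[of "w 0"] init(2) M(1) by (meson exp_le_cancel_iff of_nat_le_iff order_trans)
      moreover have "cmod (E 0 - f M 0) \<le> lower_terms_bound n d M + 2"
        using rest[of 0] radius_bounds(1)[of "Suc M"] by simp
      moreover have z0_eq: "z 0 = exp (w 0) + (E 0 - f M 0) + f M 0" by (simp add: z_def)
      ultimately show ?thesis unfolding z0_eq
        using norm_triangle_ineq[of "exp (w 0) + (E 0 - f M 0)" "f M 0"] norm_triangle_ineq[of "exp (w 0)" "E 0 - f M 0"] by linarith
    qed
    define \<delta> where "\<delta> = radius (Suc M) - middle_radius M"
    have \<delta>: "\<delta> > 0" using radius_less(2)[of M] by (simp add: \<delta>_def)
    have in1: "t \<in> ball 0 1" if "t \<in> cball 0 (radius (Suc M))" for t :: complex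
      using that radius_bounds(2)[of "Suc M"] by simp
    \<comment> \<open>The disk of radius \<open>\<delta>\<close> about each point is available for Cauchy's estimate.\<close>
    have zz: "cmod (z t - z 0) \<le> real n * (A * (A / \<delta>))" if t: "t \<in> ball 0 (middle_radius M)" for t
    proof -
      have "cmod (z t - z 0) \<le> real n * (A * (A / \<delta>)) * cmod (t - 0)"
      proof (rule field_differentiable_bound[OF convex_ball])
        fix x :: complex assume x: "x \<in> ball 0 (middle_radius M)"
        then have x1: "x \<in> ball 0 1" "x \<in> cball 0 (radius (Suc M))"
          using radius_bounds(3)[of M] radius_less(2)[of M] by auto
        show "(z has_field_derivative (\<Sum>j<n. c (2 * j) x * deriv (c (2 * j + 1)) x)) (at x within ball 0 (middle_radius M))"
          using z'[OF x1(1)] by (rule has_field_derivative_at_within)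
        have sub: "cball x \<delta> \<subseteq> cball 0 (radius (Suc M))"
          using x by (intro cball_subset_cball_iff[THEN iffD2]) (auto simp: \<delta>_def)
        have "cmod (c (2 * j) x * deriv (c (2 * j + 1)) x) \<le> A * (A / \<delta>)" if j: "j < n" for j
          unfolding norm_mult
        proof (rule mult_mono)
          show "cmod (c (2 * j) x) \<le> A" using j by (intro cA x1) (simp add: L_def)
          show "cmod (deriv (c (2 * j + 1)) x) \<le> A / \<delta>"
            using sub in1 j by (intro norm_deriv_le[OF hol(1) _ \<delta>] cA) (auto simp: L_def)
        qed (use A0 in auto)
        then show "cmod (\<Sum>j<n. c (2 * j) x * deriv (c (2 * j + 1)) x) \<le> real n * (A * (A / \<delta>))"
          using sum_norm_bound[of "{..<n}" "\<lambda>j. c (2 * j) x * deriv (c (2 * j + 1)) x" "A * (A / \<delta>)"] by simp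
      qed (use t radius_less(1)[of M] radius_bounds(1)[of M] in auto)
      also have "\<dots> \<le> real n * (A * (A / \<delta>)) * 1"
        using t A0 \<delta> radius_bounds(3)[of M] by (intro mult_left_mono) auto
      finally show ?thesis by simp
    qed
    have "\<forall>t\<in>cball 0 (radius M). cmod (c (M mod L) t / of_real (threshold M)) ^ d M \<le> (1 / 2) ^ M"
    proof (rule d(2)[of M, unfolded admissible_exponent_def, THEN spec[of _ "\<lambda>t. c (M mod L) t / of_real (threshold M)"],
        THEN spec[of _ w], THEN mp], intro conjI ballI)
      have "ball 0 (middle_radius M) \<subseteq> ball (0::complex) 1" using radius_bounds(3)[of M] by auto
      then show "(\<lambda>t. c (M mod L) t / of_real (threshold M)) holomorphic_on ball 0 (middle_radius M)"
        and "w holomorphic_on ball 0 (middle_radius M)"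
        using hol(1)[of "M mod L"] hol(2) L threshold_pos[of M]
        by (auto simp: L_def intro!: holomorphic_intros intro: holomorphic_on_subset)
      show "cmod (c (M mod L) 0 / of_real (threshold M)) \<le> 1 / 2" by (rule f0)
      show "cmod (w 0) \<le> real M" using init(2) M(1) by simp
      fix t :: complex assume t: "t \<in> ball 0 (middle_radius M)"
      then have t1: "t \<in> cball 0 (radius (Suc M))" using radius_less(2)[of M] by auto
      show "cmod (c (M mod L) t / of_real (threshold M)) \<le> amplitude n M / threshold M"
        using cA[of "M mod L", OF _ t1] L threshold_pos[of M] by (auto simp: norm_divide A_def intro!: divide_right_mono)
      have split: "exp (w t) + (c (M mod L) t / of_real (threshold M)) ^ d M = z 0 + (z t - z 0) - (E t - f M t)"
        by (simp add: z_def f_def)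
      show "cmod (exp (w t) + (c (M mod L) t / of_real (threshold M)) ^ d M) \<le> remainder_bound n d M"
        unfolding split
        using norm_triangle_ineq4[of "z 0 + (z t - z 0)" "E t - f M t"] norm_triangle_ineq[of "z 0" "z t - z 0"]
          z0 zz[OF t] rest[OF t1] unfolding remainder_bound_def \<delta>_def A_def by linarith
    qed
    moreover have "cmod (f k t) \<le> (1 / 2) ^ k" if "k > M" "t \<in> cball 0 (radius M)" for k t
      using M(2) that radius_less[of M] by (simp add: small_def)
    ultimately show ?thesis
      unfolding small_def by (metis f_def norm_power le_neq_implies_less)
  qed
  \<comment> \<open>The starting level, which depends on the disk.\<close>
  have "\<exists>M\<ge>m. small M"
  proof -
    have "\<exists>X. \<forall>t\<in>cball 0 (3 / 4). cmod (c i t) \<le> X" if "i < L" for i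
    proof -
      have "compact (c i ` cball 0 (3 / 4))"
        using hol(1)[of i] that 
        by (intro compact_continuous_image holomorphic_on_imp_continuous_on) (auto simp: L_def intro: holomorphic_on_subset)
      then show ?thesis using compact_imp_bounded bounded_iff by (metis imageI)
    qed
    then obtain X where X: "\<And>i t. i < L \<Longrightarrow> t \<in> cball 0 (3 / 4) \<Longrightarrow> cmod (c i t) \<le> X i" by metis
    define Y where "Y = (\<Sum>i<L. \<bar>X i\<bar>)"
    define M where "M = m + nat \<lceil>Y\<rceil>"
    have "cmod (f k t) \<le> (1 / 2) ^ k" if k: "k \<ge> M" "t \<in> cball 0 (radius M)" for k t
    proof -
      have "cmod (c (k mod L) t) \<le> X (k mod L)" using that radius_bounds(2)[of M] L by (intro X) auto
      also have "\<dots> \<le> Y"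
        using member_le_sum[of "k mod L" "{..<L}" "\<lambda>i. \<bar>X i\<bar>"] L by (simp add: Y_def)
      also have "\<dots> \<le> threshold k / 2" using k(1) real_nat_ceiling_ge[of Y] unfolding M_def threshold_def by simp
      finally have "cmod (c (k mod L) t / of_real (threshold k)) \<le> 1 / 2"
        using threshold_pos[of k] by (simp add: norm_divide field_simps)
      then have "cmod (f k t) \<le> (1 / 2) ^ d k" unfolding f_def norm_power by (intro power_mono) auto
      also have "\<dots> \<le> (1 / 2) ^ k" using d(1)[of k] by (intro power_decreasing) auto
      finally show ?thesis .
    qed
    then have "small M" by (simp add: small_def)
    then show ?thesis by (intro exI[of _ M]) (simp add: M_def)
  qed
  then obtain M where "m \<le> M" "small M" by blast
  then have "small m"
  proof (induction M rule: dec_induct)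
    case (step M)
    then show ?case using \<open>\<And>M. m \<le> M \<Longrightarrow> small (Suc M) \<Longrightarrow> small M\<close> by blast
  qed auto
  then have "cmod (c i t) \<le> threshold ((m + 1) * L)"
    using it radius_bounds(1)[of m] by (intro bound) (auto simp: L_def)
  also have "\<dots> \<le> amplitude n m" unfolding amplitude_def L_def by (intro threshold_mono) simp
  finally show ?thesis .
qed

section \<open>Nonvanishing of exterior powers\<close>

text \<open>
  Substituting \<open>\<tau> \<circ> \<sigma>\<close> for \<open>\<sigma>\<close> in the defining sum shows that every wedge product is alternating.
\<close>

lemma wedge_alternating:
  assumes "\<tau> permutes {..<k + l}"
  shows "wedge k l \<omega> \<eta> (\<lambda>i. v (\<tau> i)) = of_int (sign \<tau>) * wedge k l \<omega> \<eta> v"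
proof -
  let ?A = "{\<sigma>. \<sigma> permutes {..<k + l}}"
  let ?g = "\<lambda>\<sigma>. of_int (sign \<sigma>) * \<omega> (\<lambda>i. v (\<sigma> i)) * \<eta> (\<lambda>i. v (\<sigma> (k + i)))"
  have "(\<Sum>\<sigma>\<in>?A. ?g \<sigma>) = (\<Sum>\<sigma>\<in>?A. ?g (\<tau> \<circ> \<sigma>))"
    by (intro sum.reindex_bij_betw[symmetric] bij_betw_byWitness[where f' = "\<lambda>\<sigma>. inv \<tau> \<circ> \<sigma>"])
       (use assms in \<open>auto simp: permutes_inv permutes_compose o_assoc[symmetric] o_assoc permutes_inv_o\<close>)
  also have "\<dots> = (\<Sum>\<sigma>\<in>?A. of_int (sign \<tau>) * (of_int (sign \<sigma>) * \<omega> (\<lambda>i. v (\<tau> (\<sigma> i))) * \<eta> (\<lambda>i. v (\<tau> (\<sigma> (k + i))))))"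
  proof (intro sum.cong refl)
    fix \<sigma> assume "\<sigma> \<in> ?A"
    then have "sign (\<tau> \<circ> \<sigma>) = sign \<tau> * sign \<sigma>"
      using assms by (intro sign_compose) (auto simp: permutation_permutes)
    then show "?g (\<tau> \<circ> \<sigma>) = of_int (sign \<tau>) * (of_int (sign \<sigma>) * \<omega> (\<lambda>i. v (\<tau> (\<sigma> i))) * \<eta> (\<lambda>i. v (\<tau> (\<sigma> (k + i)))))"
      by simp
  qed
  finally have eq: "(\<Sum>\<sigma>\<in>?A. ?g \<sigma>) = of_int (sign \<tau>) *
    (\<Sum>\<sigma>\<in>?A. of_int (sign \<sigma>) * \<omega> (\<lambda>i. v (\<tau> (\<sigma> i))) * \<eta> (\<lambda>i. v (\<tau> (\<sigma> (k + i)))))"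
    by (simp add: sum_distrib_left)
  have "of_int (sign \<tau>) * of_int (sign \<tau>) = (1::complex)"
    by (simp add: sign_def)
  with eq show ?thesis
    unfolding wedge_def by (simp add: mult.assoc[symmetric])
qed

lemma wedge_power_alternating:
  assumes "\<tau> permutes {..<j * 2}"
  shows "wedge_power 2 \<omega> j (\<lambda>i. v (\<tau> i)) = of_int (sign \<tau>) * wedge_power 2 \<omega> j v"
proof (cases j)
  case 0
  then show ?thesis using assms by simp
next
  case (Suc i)
  then show ?thesis using assms wedge_alternating[of \<tau> 2 "i * 2" \<omega> "wedge_power 2 \<omega> i" v] by simp
qed

text \<open>
  This transports the alternation of a factor to the positions that it occupies in a wedge
  product.
\<close>

lemma permutation_tail:
  fixes k l :: nat
  assumes "\<sigma> permutes {..<k + l}" and low: "\<And>i. i < k \<Longrightarrow> \<sigma> i = i"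
  obtains \<tau> where "\<tau> permutes {..<l}" "sign \<tau> = sign \<sigma>" "\<And>i. \<sigma> (k + i) = k + \<tau> i"
proof -
  have \<sigma>': "\<sigma> permutes {k..<k + l}"
    by (rule permutes_superset[OF assms(1)]) (metis DiffE atLeastLessThan_iff lessThan_iff low not_le)
  have bij: "bij_betw (\<lambda>i. i - k) {k..<k + l} {..<l}"
    by (rule bij_betw_byWitness[where f' = "\<lambda>i. i + k"]) auto
  define \<tau> where "\<tau> = map_permutation {k..<k + l} (\<lambda>i. i - k) \<sigma>"
  have p: "\<tau> permutes {..<l}"
    unfolding \<tau>_def by (rule map_permutation_permutes[OF bij \<sigma>'])
  have s: "sign \<tau> = sign \<sigma>"
    unfolding \<tau>_def by (rule sign_map_permutation[OF bij_betw_imp_inj_on[OF bij] \<sigma>']) auto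
  have "\<sigma> (k + i) = k + \<tau> i" for i
  proof (cases "i < l")
    case True
    then have "\<tau> ((k + i) - k) = \<sigma> (k + i) - k"
      unfolding \<tau>_def by (intro map_permutation_apply[OF bij_betw_imp_inj_on[OF bij]]) auto
    moreover have "\<sigma> (k + i) \<in> {k..<k + l}" using permutes_in_image[OF \<sigma>', of "k + i"] True by auto
    ultimately show ?thesis by auto
  next
    case False
    then show ?thesis using permutes_not_in[OF \<sigma>', of "k + i"] permutes_not_in[OF p, of i] by auto
  qed
  with p s that show ?thesis by blast
qed

text \<open>
  On a symplectic basis the powers of a symplectic form do not vanish. The argument avoids
  counting: expanding one factor \<open>\<omega>\<close> of \<open>\<omega>\<^sup>j\<^sup>+\<^sup>1\<close>, a permutation contributes only if it puts the two
  vectors of one symplectic pair into this factor, and then alternation turns its contribution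
  into the one of the remaining pairs in standard order, which is \<open>- K\<close> by induction. All nonzero
  contributions being equal, the sum cannot cancel. For the induction the value \<open>K\<close> has to be the
  same for every choice \<open>p\<close> of \<open>j\<close> pairs.
\<close>

lemma wedge_power_symplectic:
  assumes \<omega>: "\<And>u. (\<omega> :: 'a form) u = (\<Sum>j<n. X j (u 1) * Y j (u 0) - X j (u 0) * Y j (u 1))"
    and e: "\<And>i j. i < n \<Longrightarrow> j < n \<Longrightarrow> X i (e (2 * j)) = of_bool (i = j)"
       "\<And>i j. i < n \<Longrightarrow> j < n \<Longrightarrow> X i (e (2 * j + 1)) = 0"
       "\<And>i j. i < n \<Longrightarrow> j < n \<Longrightarrow> Y i (e (2 * j)) = 0"
       "\<And>i j. i < n \<Longrightarrow> j < n \<Longrightarrow> Y i (e (2 * j + 1)) = of_bool (i = j)"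
  shows "\<exists>K. K \<noteq> 0 \<and> (\<forall>p. inj_on p {..<j} \<and> p ` {..<j} \<subseteq> {..<n} \<longrightarrow>
           wedge_power 2 \<omega> j (\<lambda>i. e (2 * p (i div 2) + i mod 2)) = K)"
proof (induction j)
  case 0
  show ?case by (rule exI[of _ 1]) simp
next
  case (Suc j)
  then obtain K where K: "K \<noteq> 0" "\<And>p. inj_on p {..<j} \<Longrightarrow> p ` {..<j} \<subseteq> {..<n} \<Longrightarrow>
      wedge_power 2 \<omega> j (\<lambda>i. e (2 * p (i div 2) + i mod 2)) = K" by blast
  define B where "B = {\<sigma>. \<sigma> permutes {..<2 + j * 2} \<and> \<sigma> 0 div 2 = (\<sigma> 1 :: nat) div 2}"
  have finB: "finite B" unfolding B_def by (rule finite_subset[OF _ finite_permutations[of "{..<2 + j * 2}"]]) auto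
  have "id \<in> B" by (auto simp: B_def permutes_id)
  with finB have cardB: "card B \<noteq> 0" by auto
  define K' where "K' = - K * of_nat (card B) / (fact 2 * fact (j * 2))"
  have "wedge_power 2 \<omega> (Suc j) (\<lambda>i. e (2 * p (i div 2) + i mod 2)) = K'"
    if p: "inj_on p {..<Suc j}" "p ` {..<Suc j} \<subseteq> {..<n}" for p
  proof -
    define v where "v i = e (2 * p (i div 2) + i mod 2)" for i
    define T where "T \<sigma> = of_int (sign \<sigma>) * \<omega> (\<lambda>i. v (\<sigma> i)) * wedge_power 2 \<omega> j (\<lambda>i. v (\<sigma> (2 + i)))" for \<sigma>
    have pn: "p a < n" if "a < Suc j" for a using p(2) that by auto
    have Xv: "X i (v a) = of_bool (i = p (a div 2) \<and> even a)"
      and Yv: "Y i (v a) = of_bool (i = p (a div 2) \<and> odd a)" if "i < n" "a < 2 + j * 2" for i a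
      using that e[of i "p (a div 2)"] pn[of "a div 2"] by (auto simp: v_def mod2_eq_if less_Suc_eq_le)
    have wv: "\<omega> u = of_bool (p (a div 2) = p (b div 2) \<and> even b \<and> odd a) - of_bool (p (a div 2) = p (b div 2) \<and> even a \<and> odd b)"
      if "u 0 = v a" "u 1 = v b" "a < 2 + j * 2" "b < 2 + j * 2" for u a b
    proof -
      have "\<omega> u = (\<Sum>i<n. (if i = p (a div 2) then of_bool (p (a div 2) = p (b div 2) \<and> even b \<and> odd a) - of_bool (p (a div 2) = p (b div 2) \<and> even a \<and> odd b) else 0))"
        unfolding \<omega> that(1,2) by (intro sum.cong refl) (use that in \<open>auto simp: Xv Yv\<close>)
      also have "\<dots> = of_bool (p (a div 2) = p (b div 2) \<and> even b \<and> odd a) - of_bool (p (a div 2) = p (b div 2) \<and> even a \<and> odd b)"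
        using pn[of "a div 2"] that by (subst sum.delta) auto
      finally show ?thesis .
    qed
    have Tinv: "T (\<sigma> \<circ> \<tau>) = T \<sigma>" if st: "\<sigma> permutes {..<2 + j * 2}" "\<tau> permutes {..<2 + j * 2}" "\<tau> 0 = 0" "\<tau> 1 = 1" for \<sigma> \<tau>
    proof -
      obtain \<tau>' where t: "\<tau>' permutes {..<j * 2}" "sign \<tau>' = sign \<tau>" "\<And>i. \<tau> (2 + i) = 2 + \<tau>' i"
        using permutation_tail[OF st(2)] st(3,4) by (metis less_2_cases One_nat_def)
      have "wedge_power 2 \<omega> j (\<lambda>i. v (\<sigma> (2 + \<tau>' i))) = of_int (sign \<tau>') * wedge_power 2 \<omega> j (\<lambda>i. v (\<sigma> (2 + i)))"
        by (rule wedge_power_alternating[OF t(1), of _ "\<lambda>i. v (\<sigma> (2 + i))"])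
      moreover have "sign (\<sigma> \<circ> \<tau>) = sign \<sigma> * sign \<tau>"
        using that by (intro sign_compose) (auto simp: permutation_permutes)
      moreover have "\<omega> (\<lambda>i. v (\<sigma> (\<tau> i))) = \<omega> (\<lambda>i. v (\<sigma> i))"
        using that by (simp add: \<omega>)
      moreover have "of_int (sign \<tau>) * of_int (sign \<tau>) = (1::complex)"
        by (simp add: sign_def)
      ultimately show ?thesis
        unfolding T_def o_apply t(3) by (simp add: t(2) o_def)
    qed
    have Tswap: "T (\<sigma> \<circ> Transposition.transpose 0 1) = T \<sigma>" if "\<sigma> permutes {..<2 + j * 2}" for \<sigma>
    proof -
      have "sign (\<sigma> \<circ> Transposition.transpose 0 1) = - sign \<sigma>"
        using permutation_permutes[THEN iffD2, OF exI[of _ "{..<2 + j * 2}"]] that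
        by (simp add: sign_compose sign_swap_id permutation_swap_id)
      moreover have "\<omega> (\<lambda>i. v (\<sigma> (Transposition.transpose 0 1 i))) = - \<omega> (\<lambda>i. v (\<sigma> i))"
        by (simp add: \<omega> sum_negf[symmetric])
      moreover have "Transposition.transpose 0 1 (2 + i) = 2 + i" for i :: nat
        by (simp add: Transposition.transpose_def)
      ultimately show ?thesis by (simp add: T_def)
    qed
    have T0: "T \<sigma> = - K" if s: "\<sigma> permutes {..<2 + j * 2}" "\<sigma> 0 = 2 * a" "\<sigma> 1 = 2 * a + 1" for \<sigma> a
    proof -
      \<comment> \<open>An even permutation that exchanges the first pair and the pair \<open>a\<close>; the permutation \<open>\<sigma>\<close>
        differs from it only in the last places.\<close>
      define \<rho> :: "nat \<Rightarrow> nat" where "\<rho> = Transposition.transpose 0 (2 * a) \<circ> Transposition.transpose 1 (2 * a + 1)"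
      have "2 * a < 2 + j * 2" using permutes_in_image[OF s(1), of 0] s(2) by simp
      then have a: "a < Suc j" by simp
      have \<rho>p: "\<rho> permutes {..<2 + j * 2}"
        unfolding \<rho>_def using a by (intro permutes_compose permutes_swap_id) auto
      have \<rho>s: "sign \<rho> = 1"
        unfolding \<rho>_def by (subst sign_compose) (auto simp: sign_swap_id permutation_swap_id)
      have \<rho>01: "\<rho> 0 = 2 * a" "\<rho> 1 = 2 * a + 1"
        by (auto simp: \<rho>_def Transposition.transpose_def)
      have "inv \<rho> \<circ> \<sigma> permutes {..<2 + j * 2}"
        using permutes_compose[OF s(1) permutes_inv[OF \<rho>p]] .
      moreover have "(inv \<rho> \<circ> \<sigma>) 0 = 0" "(inv \<rho> \<circ> \<sigma>) 1 = 1"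
        using \<rho>01 s(2,3) permutes_inverses(2)[OF \<rho>p] by (metis o_apply)+
      ultimately have "T (\<rho> \<circ> (inv \<rho> \<circ> \<sigma>)) = T \<rho>"
        by (intro Tinv \<rho>p)
      then have "T \<sigma> = T \<rho>"
        using permutes_inv_o(1)[OF \<rho>p] by (simp add: o_assoc)
      also have "T \<rho> = - K"
      proof -
        have w: "\<omega> (\<lambda>i. v (\<rho> i)) = - 1"
          using wv[of "\<lambda>i. v (\<rho> i)" "\<rho> 0" "\<rho> 1"] a by (simp add: \<rho>01[unfolded One_nat_def] \<rho>01)
        \<comment> \<open>The enumeration of the other pairs that results: the first pair takes the place of \<open>a\<close>.\<close>
        define p' where "p' i = (if Suc i = a then p 0 else p (Suc i))" for i
        have "v (\<rho> (2 + i)) = e (2 * p' (i div 2) + i mod 2)" for i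
        proof -
          have "\<rho> (2 + i) = (if Suc (i div 2) = a then i mod 2 else 2 + i)"
            unfolding \<rho>_def Transposition.transpose_def by auto presburger+
          then show ?thesis unfolding v_def p'_def by auto
        qed
        then have "wedge_power 2 \<omega> j (\<lambda>i. v (\<rho> (2 + i))) = wedge_power 2 \<omega> j (\<lambda>i. e (2 * p' (i div 2) + i mod 2))"
          by simp
        also have "\<dots> = K"
        proof (rule K(2))
          show "inj_on p' {..<j}"
            using p(1) a unfolding inj_on_def p'_def by (auto split: if_splits) 
          show "p' ` {..<j} \<subseteq> {..<n}"
            using pn by (auto simp: p'_def)
        qed
        finally show ?thesis using w by (simp add: T_def \<rho>s)
      qed
      finally show ?thesis .
    qed
    have TB: "T \<sigma> = - K" if "\<sigma> \<in> B" for \<sigma>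
    proof -
      have s: "\<sigma> permutes {..<2 + j * 2}" "\<sigma> 0 div 2 = \<sigma> 1 div 2" using that by (auto simp: B_def)
      have split: "x = 2 * (x div 2) \<and> y = 2 * (x div 2) + 1 \<or> y = 2 * (x div 2) \<and> x = 2 * (x div 2) + 1"
        if "x \<noteq> y" "x div 2 = y div 2" for x y :: nat
        using that by presburger
      have "\<sigma> 0 \<noteq> \<sigma> 1" using permutes_inj[OF s(1)] by (metis injD zero_neq_one)
      then consider "\<sigma> 0 = 2 * (\<sigma> 0 div 2)" "\<sigma> 1 = 2 * (\<sigma> 0 div 2) + 1" | "\<sigma> 1 = 2 * (\<sigma> 0 div 2)" "\<sigma> 0 = 2 * (\<sigma> 0 div 2) + 1"
        using split[of "\<sigma> 0" "\<sigma> 1"] s(2) by blast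
      then show ?thesis
      proof cases
        case 1
        show ?thesis by (rule T0[OF s(1) 1])
      next
        case 2
        have "T (\<sigma> \<circ> Transposition.transpose 0 1) = - K"
          by (rule T0[where a = "\<sigma> 0 div 2"]) (use 2 s in \<open>auto intro!: permutes_compose permutes_swap_id\<close>)
        then show ?thesis using Tswap[OF s(1)] by simp
      qed
    qed
    have Tn: "T \<sigma> = 0" if "\<sigma> permutes {..<2 + j * 2}" "\<sigma> \<notin> B" for \<sigma>
    proof -
      have *: "\<sigma> 0 < 2 + j * 2" "\<sigma> 1 < 2 + j * 2" using permutes_in_image[OF that(1)] by auto
      have "p (\<sigma> 0 div 2) \<noteq> p (\<sigma> 1 div 2)"
        using that * p(1) by (auto simp: B_def inj_on_def)
      then have "\<omega> (\<lambda>i. v (\<sigma> i)) = 0" using wv[of "\<lambda>i. v (\<sigma> i)" "\<sigma> 0" "\<sigma> 1"] * by simp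
      then show ?thesis by (simp add: T_def)
    qed
    have "(\<Sum>\<sigma> | \<sigma> permutes {..<2 + j * 2}. T \<sigma>) = (\<Sum>\<sigma>\<in>B. T \<sigma>)"
      by (rule sum.mono_neutral_right) (use Tn finite_permutations in \<open>auto simp: B_def\<close>)
    also have "\<dots> = - K * of_nat (card B)" using TB by simp
    finally show ?thesis
      by (simp add: wedge_def T_def v_def K'_def)
  qed
  moreover have "K' \<noteq> 0" using K(1) cardB by (simp add: K'_def)
  ultimately show ?case by blast
qed

text \<open>
  If \<open>v\<close> continues a vector by elements of the kernel of \<open>\<beta>\<close>, only the permutations that fix the
  first place contribute to \<open>\<beta> \<and> \<eta>\<close>, and they all contribute the same.
\<close>

lemma wedge_1_adapted:
  assumes \<eta>: "\<And>\<tau> u. \<tau> permutes {..<l} \<Longrightarrow> \<eta> (\<lambda>i. u (\<tau> i)) = of_int (sign \<tau>) * \<eta> u"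
    and tail: "\<And>i. i < l \<Longrightarrow> \<beta> (v (Suc i)) = 0"
  shows "wedge 1 l (\<lambda>u. \<beta> (u 0)) \<eta> v =
    of_nat (card {\<sigma>. \<sigma> permutes {..<1 + l} \<and> \<sigma> 0 = 0}) * (\<beta> (v 0) * \<eta> (\<lambda>i. v (Suc i))) / fact l"
proof -
  let ?A = "{\<sigma>. \<sigma> permutes {..<1 + l}}" and ?B = "{\<sigma>. \<sigma> permutes {..<1 + l} \<and> \<sigma> 0 = 0}"
  let ?T = "\<lambda>\<sigma>. of_int (sign \<sigma>) * \<beta> (v (\<sigma> 0)) * \<eta> (\<lambda>i. v (\<sigma> (1 + i)))"
  have "?T \<sigma> = 0" if "\<sigma> \<in> ?A - ?B" for \<sigma>
  proof -
    have "\<sigma> 0 < 1 + l" using that permutes_in_image[of \<sigma> "{..<1 + l}" 0] by simp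
    then have "\<beta> (v (\<sigma> 0)) = 0" using that tail[of "\<sigma> 0 - 1"] by auto
    then show ?thesis by simp
  qed
  then have "(\<Sum>\<sigma>\<in>?A. ?T \<sigma>) = (\<Sum>\<sigma>\<in>?B. ?T \<sigma>)"
    using finite_permutations[of "{..<1 + l}"] by (intro sum.mono_neutral_right) auto
  also have "\<dots> = (\<Sum>\<sigma>\<in>?B. \<beta> (v 0) * \<eta> (\<lambda>i. v (Suc i)))"
  proof (intro sum.cong refl)
    fix \<sigma> assume "\<sigma> \<in> ?B"
    then obtain \<tau> where \<tau>: "\<tau> permutes {..<l}" "sign \<tau> = sign \<sigma>" "\<And>i. \<sigma> (1 + i) = 1 + \<tau> i"
      using permutation_tail[of \<sigma> 1 l] by auto
    have "of_int (sign \<tau>) * of_int (sign \<tau>) = (1::complex)" by (simp add: sign_def)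
    then show "?T \<sigma> = \<beta> (v 0) * \<eta> (\<lambda>i. v (Suc i))"
      using \<open>\<sigma> \<in> ?B\<close> \<eta>[OF \<tau>(1), of "\<lambda>i. v (Suc i)"] unfolding \<tau>(3) by (simp add: \<tau>(2)[symmetric])
  qed
  finally show ?thesis unfolding wedge_def by simp
qed

section \<open>The contact form\<close>

context
  fixes n :: nat and e :: "nat \<Rightarrow> 'm::finite" and g g' :: "nat \<Rightarrow> complex \<Rightarrow> complex"
begin

text \<open>
  The pullback of \<open>dz - \<Sum> c\<^sub>2\<^sub>j dc\<^sub>2\<^sub>j\<^sub>+\<^sub>1\<close> under \<open>z = e\<^sup>w + \<Sum> P\<^sub>i(c\<^sub>i)\<close>, where \<open>g i\<close> is the derivative of
  \<open>P\<^sub>i\<close>. The map \<open>e\<close> enumerates the coordinates, \<open>w\<close> being the last one.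
\<close>

definition exp_form :: "complex ^ 'm \<Rightarrow> complex ^ 'm \<Rightarrow> complex" where
  "exp_form z v = exp (z $ e (2 * n)) * v $ e (2 * n) + (\<Sum>i<2 * n. g i (z $ e i) * v $ e i)
     - (\<Sum>j<n. z $ e (2 * j) * v $ e (2 * j + 1))"

definition exp_form_deriv :: "complex ^ 'm \<Rightarrow> complex ^ 'm \<Rightarrow> complex ^ 'm \<Rightarrow> complex" where
  "exp_form_deriv z v h = exp (z $ e (2 * n)) * h $ e (2 * n) * v $ e (2 * n)
     + (\<Sum>i<2 * n. g' i (z $ e i) * h $ e i * v $ e i) - (\<Sum>j<n. h $ e (2 * j) * v $ e (2 * j + 1))"

context
  assumes g: "\<And>i u. (g i has_field_derivative g' i u) (at u)"
begin

lemma exp_form_has_derivative: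
  "((\<lambda>z. exp_form z v) has_derivative exp_form_deriv z v) (at z)"
proof -
  have nth: "((\<lambda>z. z $ i) has_derivative (\<lambda>h. h $ i)) (at z)" for i :: 'm
    by (rule bounded_linear.has_derivative[OF bounded_linear_vec_nth has_derivative_ident])
  have comp: "((\<lambda>z. h (z $ i)) has_derivative (\<lambda>x. h' * x $ i)) (at z)"
    if "(h has_field_derivative h') (at (z $ i))" for h h' and i :: 'm
    using has_derivative_compose[OF nth, of h "(*) h'"] that by (simp add: has_field_derivative_def)
  show ?thesis
    unfolding exp_form_def exp_form_deriv_def
    by (intro has_derivative_diff has_derivative_add has_derivative_sum has_derivative_mult_left comp DERIV_exp g nth)
qed

lemma holomorphic_1form_exp_form: "holomorphic_1form exp_form"
proof -
  have lin: "Vector_Spaces.linear (*s) (*) (exp_form z)"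
    and lin': "Vector_Spaces.linear (*s) (*) (exp_form_deriv z v)" for z v
    by (auto simp: Vector_Spaces.linear_iff vec.vector_space_axioms vector_space_over_itself.vector_space_axioms
        exp_form_def exp_form_deriv_def algebra_simps sum.distrib sum_distrib_left)
  then show ?thesis
    unfolding holomorphic_1form_def holomorphic_function_def using exp_form_has_derivative by blast
qed

text \<open>
  The summands of \<open>exp_form\<close> with \<open>exp\<close> and \<open>g\<close> are differentials of functions of one coordinate
  each, so their contributions are symmetric and cancel.
\<close>

lemma ext_deriv_exp_form:
  "ext_deriv exp_form z u =
     (\<Sum>j<n. u 1 $ e (2 * j) * u 0 $ e (2 * j + 1) - u 0 $ e (2 * j) * u 1 $ e (2 * j + 1))"
proof -
  have "frechet_derivative (\<lambda>z. exp_form z v) (at z) = exp_form_deriv z v" for v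
    using frechet_derivative_at[OF exp_form_has_derivative] by metis
  then show ?thesis
    by (simp add: ext_deriv_def exp_form_deriv_def sum_subtractf mult_ac)
qed

text \<open>
  The form takes the value \<open>e\<^sup>w \<noteq> 0\<close> on the direction of \<open>w\<close>, and its exterior derivative does not
  see this direction. So the other coordinate directions may be corrected by multiples of it
  into a symplectic basis of the kernel.
\<close>

lemma holomorphic_contact_form_exp_form:
  assumes e: "inj_on e {..2 * n}"
  shows "holomorphic_contact_form n exp_form"
  unfolding holomorphic_contact_form_def
proof (intro conjI allI holomorphic_1form_exp_form)
  fix z
  define \<omega> where "\<omega> = ext_deriv exp_form z"
  define W :: "complex ^ 'm" where "W = axis (e (2 * n)) 1"
  define r where "r i = exp_form z (axis (e i) 1) / exp (z $ e (2 * n))" for i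
  define E where "E i = axis (e i) 1 - r i *s W" for i
  have ee: "e i = e j \<longleftrightarrow> i = j" if "i \<le> 2 * n" "j \<le> 2 * n" for i j
    using that inj_on_eq_iff[OF e] by simp
  have W: "exp_form z W = exp (z $ e (2 * n))"
    by (simp add: W_def exp_form_def axis_def ee)
  interpret lin: Vector_Spaces.linear "(*s)" "(*)" "exp_form z"
    using holomorphic_1form_exp_form by (simp add: holomorphic_1form_def)
  have E0: "exp_form z (E i) = 0" for i
    unfolding E_def by (simp add: lin.diff lin.scale W r_def)
  have E_nth: "E i $ e j = of_bool (i = j)" if "i < 2 * n" "j < 2 * n" for i j
    using that by (simp add: E_def W_def axis_def ee)
  have "\<exists>K. K \<noteq> 0 \<and> (\<forall>p. inj_on p {..<n} \<and> p ` {..<n} \<subseteq> {..<n} \<longrightarrow>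
           wedge_power 2 \<omega> n (\<lambda>i. E (2 * p (i div 2) + i mod 2)) = K)"
  proof (rule wedge_power_symplectic[where X = "\<lambda>j v. v $ e (2 * j)" and Y = "\<lambda>j v. v $ e (2 * j + 1)" and n = n])
    show "\<omega> u = (\<Sum>j<n. u 1 $ e (2 * j) * u 0 $ e (2 * j + 1) - u 0 $ e (2 * j) * u 1 $ e (2 * j + 1))" for u
      unfolding \<omega>_def by (rule ext_deriv_exp_form)
  qed (auto simp: E_nth, presburger+)
  then obtain K where K: "K \<noteq> 0" "\<And>p. inj_on p {..<n} \<Longrightarrow> p ` {..<n} \<subseteq> {..<n} \<Longrightarrow>
      wedge_power 2 \<omega> n (\<lambda>i. E (2 * p (i div 2) + i mod 2)) = K" by blast
  have KE: "wedge_power 2 \<omega> n E = K"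
    using K(2)[of "\<lambda>i. i"] by simp
  define v where "v i = (if i = 0 then W else E (i - 1))" for i :: nat
  let ?B = "{\<sigma>. \<sigma> permutes {..<1 + 2 * n} \<and> \<sigma> 0 = (0::nat)}"
  have "wedge 1 (2 * n) (\<lambda>v. exp_form z (v 0)) (wedge_power 2 \<omega> n) v
      = of_nat (card ?B) * (exp_form z (v 0) * wedge_power 2 \<omega> n (\<lambda>i. v (Suc i))) / fact (2 * n)"
    by (rule wedge_1_adapted) (auto simp: wedge_power_alternating mult.commute[of 2 n] v_def E0)
  also have "\<dots> = of_nat (card ?B) * (exp (z $ e (2 * n)) * K) / fact (2 * n)"
    by (simp add: v_def W KE)
  also have "\<dots> \<noteq> 0"
  proof -
    have "finite ?B" by (rule finite_subset[OF _ finite_permutations[of "{..<1 + 2 * n}"]]) auto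
    moreover have "id \<in> ?B" by (simp add: permutes_id)
    ultimately have "card ?B \<noteq> 0" by (metis card_eq_0_iff empty_iff)
    with K(1) show ?thesis by simp
  qed
  finally show "wedge 1 (2 * n) (\<lambda>v. exp_form z (v 0)) (wedge_power 2 (ext_deriv exp_form z) n) \<noteq> (\<lambda>v. 0)"
    unfolding \<omega>_def by (metis (mono_tags, lifting))
qed

end

lemma horizontal_disk_exp_form:
  assumes "horizontal_disk (kernel_bundle exp_form) f" "t \<in> ball 0 1"
  defines "c \<equiv> \<lambda>i t. f t $ e i"
  shows "exp (c (2 * n) t) * deriv (c (2 * n)) t + (\<Sum>i<2 * n. g i (c i t) * deriv (c i) t)
     = (\<Sum>j<n. c (2 * j) t * deriv (c (2 * j + 1)) t)"
  using assms by (simp add: horizontal_disk_def kernel_bundle_def exp_form_def complex_velocity_def)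

end

section \<open>Lower bounds for the directed distance\<close>

lemma norm_vector_scalar_mult_complex: "norm (c *s v) = cmod c * norm (v :: complex ^ 'm)"
  by (simp add: norm_vec_def norm_mult L2_set_right_distrib)

lemma directed_norm_lower_bound:
  fixes \<xi> :: "complex ^ 'm \<Rightarrow> (complex ^ 'm) set"
  assumes "M > 0" and "\<And>f. horizontal_disk \<xi> f \<Longrightarrow> f 0 = p \<Longrightarrow> norm (complex_velocity f 0) \<le> M"
  shows "ennreal (norm v / M) \<le> directed_norm \<xi> p v"
  unfolding directed_norm_def
proof (rule Inf_greatest, safe)
  fix c f assume c: "c \<noteq> 0" and f: "horizontal_disk \<xi> f" "complex_velocity f 0 = c *s v" "p = f 0"
  have "cmod c * norm v \<le> M"
    using assms(2)[OF f(1)] f by (simp add: norm_vector_scalar_mult_complex)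
  then show "ennreal (norm v / M) \<le> ennreal (1 / cmod c)"
    using c assms(1) by (intro ennreal_leI) (simp add: field_simps)
qed

lemma horizontal_path_regular:
  assumes "horizontal_path \<xi> \<gamma>"
  shows "continuous_on {0..1} \<gamma>" "\<exists>S. finite S \<and> (\<forall>t\<in>{0<..<1} - S. \<gamma> differentiable (at t))"
proof -
  obtain N s where s: "s 0 = (0::real)" "s N = 1"
    "\<And>i. i < N \<Longrightarrow> s i < s (Suc i) \<and> smooth_on_interval (s i) (s (Suc i)) \<gamma>"
    using assms unfolding horizontal_path_def by blast
  have "0 \<le> s i \<and> continuous_on {0..s i} \<gamma> \<and> (\<exists>S. finite S \<and> (\<forall>t\<in>{0<..<s i} - S. \<gamma> differentiable (at t)))"
    if "i \<le> N" for i
    using that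
  proof (induction i)
    case 0
    then show ?case by (auto simp: s(1))
  next
    case (Suc i)
    then obtain S where IH: "0 \<le> s i" "continuous_on {0..s i} \<gamma>" "finite S"
      "\<And>t. t \<in> {0<..<s i} - S \<Longrightarrow> \<gamma> differentiable (at t)" by auto
    have i: "s i < s (Suc i)" "smooth_on_interval (s i) (s (Suc i)) \<gamma>" using s(3)[of i] Suc.prems by auto
    then obtain g where g: "\<And>t. t \<in> {s i..s (Suc i)} \<Longrightarrow> (\<gamma> has_vector_derivative g t) (at t within {s i..s (Suc i)})"
      unfolding smooth_on_interval_def by metis
    have "continuous_on {s i..s (Suc i)} \<gamma>"
      using g has_vector_derivative_continuous continuous_on_eq_continuous_within by blast
    then have "continuous_on ({0..s i} \<union> {s i..s (Suc i)}) \<gamma>"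
      by (intro continuous_on_closed_Un IH) auto
    moreover have "{0..s i} \<union> {s i..s (Suc i)} = {0..s (Suc i)}" using IH(1) i(1) by auto
    moreover have "\<forall>t\<in>{0<..<s (Suc i)} - insert (s i) S. \<gamma> differentiable (at t)"
    proof
      fix t assume t: "t \<in> {0<..<s (Suc i)} - insert (s i) S"
      show "\<gamma> differentiable (at t)"
      proof (cases "t < s i")
        case True
        then show ?thesis using IH(4) t by auto
      next
        case False
        then have "t \<in> {s i<..<s (Suc i)}" using t by auto
        then have "(\<gamma> has_vector_derivative g t) (at t)"
          using g[of t] at_within_Icc_at[of "s i" t "s (Suc i)"] by auto
        then show ?thesis by (rule differentiableI_vector)
      qed
    qed
    moreover have "finite (insert (s i) S)" using IH(3) by simp
    ultimately show ?case using IH(1) i(1) by (metis less_imp_le order_trans)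
  qed
  from this[of N] show "continuous_on {0..1} \<gamma>" "\<exists>S. finite S \<and> (\<forall>t\<in>{0<..<1} - S. \<gamma> differentiable (at t))"
    using s(2) by auto
qed

text \<open>
  If the integral on the right is finite, then the derivative, which always has a gauge integral,
  is Lebesgue integrable.
\<close>

lemma norm_increment_le_nn_integral:
  fixes f f' :: "real \<Rightarrow> 'a::euclidean_space"
  assumes "finite S" "a \<le> b" "\<And>x. x \<in> {a<..<b} - S \<Longrightarrow> (f has_vector_derivative f' x) (at x)"
    "continuous_on {a..b} f"
  shows "ennreal (norm (f b - f a)) \<le> (\<integral>\<^sup>+x\<in>{a..b}. ennreal (norm (f' x)) \<partial>lborel)"
proof (cases "(\<integral>\<^sup>+x\<in>{a..b}. ennreal (norm (f' x)) \<partial>lborel) = \<infinity>")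
  case False
  have int: "(f' has_integral (f b - f a)) {a..b}"
    by (rule fundamental_theorem_of_calculus_interior_strong[OF assms])
  have eq: "(\<integral>\<^sup>+x. ennreal (norm (f' x)) \<partial>lebesgue_on {a..b}) = (\<integral>\<^sup>+x\<in>{a..b}. ennreal (norm (f' x)) \<partial>lborel)"
    by (simp add: nn_integral_restrict_space nn_integral_completion)
  have "integrable (lebesgue_on {a..b}) f'"
    using int False integrable_imp_measurable[of f' "{a..b}"]
    by (intro integrableI_bounded) (auto simp: eq less_top[symmetric])
  then have "(f' has_integral (integral\<^sup>L (lebesgue_on {a..b}) f')) {a..b}"
    by (intro has_integral_integral_lebesgue_on) auto
  with int have "f b - f a = integral\<^sup>L (lebesgue_on {a..b}) f'"
    by (rule has_integral_unique)
  with integral_norm_bound_ennreal[OF \<open>integrable _ f'\<close>] show ?thesis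
    by (simp add: eq)
qed simp

text \<open>
  Up to the first time at which the path leaves the ball of radius \<open>r\<close> the directed norm dominates
  a multiple of the Euclidean one.
\<close>

lemma directed_length_lower_bound:
  fixes \<xi> :: "complex ^ 'm \<Rightarrow> (complex ^ 'm) set"
  assumes "M > 0" "0 < r" and M: "\<And>p v. dist (\<gamma> 0) p \<le> r \<Longrightarrow> ennreal (norm v / M) \<le> directed_norm \<xi> p v"
    and \<gamma>: "horizontal_path \<xi> \<gamma>" "r \<le> dist (\<gamma> 0) (\<gamma> 1)"
  shows "ennreal (r / M) \<le> directed_length \<xi> \<gamma>"
proof -
  note cont = horizontal_path_regular(1)[OF \<gamma>(1)]
  obtain S where S: "finite S" "\<And>t. t \<in> {0<..<1} - S \<Longrightarrow> \<gamma> differentiable (at t)"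
    using horizontal_path_regular(2)[OF \<gamma>(1)] by auto
  define A where "A = {t \<in> {0..1}. r \<le> dist (\<gamma> 0) (\<gamma> t)}"
  have "closed A" unfolding A_def
    by (intro continuous_on_closed_Collect_le continuous_intros cont)
  then have "compact A" "A \<noteq> {}" using \<gamma>(2)
    by (auto simp: A_def compact_eq_bounded_closed intro: bounded_subset[of "{0..1::real}"])
  then obtain \<tau> where \<tau>: "\<tau> \<in> A" "\<And>t. t \<in> A \<Longrightarrow> \<tau> \<le> t"
    using compact_attains_inf by metis
  have \<tau>01: "0 \<le> \<tau>" "\<tau> \<le> 1" "r \<le> dist (\<gamma> 0) (\<gamma> \<tau>)" using \<tau>(1) by (auto simp: A_def)
  have before: "dist (\<gamma> 0) (\<gamma> t) \<le> r" if "t \<in> {0..<\<tau>}" for t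
    using \<tau>(2)[of t] that \<tau>01 by (force simp: A_def)
  define \<gamma>' where "\<gamma>' t = vector_derivative \<gamma> (at t within {0..1})" for t
  have "r / M \<le> norm (\<gamma> \<tau> /\<^sub>R M - \<gamma> 0 /\<^sub>R M)"
    using \<tau>01(3) assms(1)
    by (simp add: scaleR_diff_right[symmetric] dist_norm norm_minus_commute divide_inverse mult.commute)
  then have "ennreal (r / M) \<le> ennreal (norm (\<gamma> \<tau> /\<^sub>R M - \<gamma> 0 /\<^sub>R M))"
    by (rule ennreal_leI)
  also have "\<dots> \<le> (\<integral>\<^sup>+t\<in>{0..\<tau>}. ennreal (norm (\<gamma>' t /\<^sub>R M)) \<partial>lborel)"
  proof (rule norm_increment_le_nn_integral[OF S(1) \<tau>01(1)])
    show "continuous_on {0..\<tau>} (\<lambda>t. \<gamma> t /\<^sub>R M)"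
      using cont \<tau>01 by (intro continuous_intros continuous_on_subset[OF cont]) auto
    fix t assume "t \<in> {0<..<\<tau>} - S"
    then have t: "t \<in> {0<..<1} - S" using \<tau>01 by auto
    then have "(\<gamma> has_vector_derivative \<gamma>' t) (at t)"
      using S(2)[OF t] unfolding \<gamma>'_def by (simp add: at_within_Icc_at vector_derivative_works)
    then show "((\<lambda>t. \<gamma> t /\<^sub>R M) has_vector_derivative \<gamma>' t /\<^sub>R M) (at t)"
      by (rule bounded_linear.has_vector_derivative[OF bounded_linear_scaleR_right])
  qed
  also have "\<dots> \<le> directed_length \<xi> \<gamma>"
    unfolding directed_length_def
  proof (rule nn_integral_mono_AE)
    show "AE t in lborel. ennreal (norm (\<gamma>' t /\<^sub>R M)) * indicator {0..\<tau>} t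
        \<le> directed_norm \<xi> (\<gamma> t) (vector_derivative \<gamma> (at t within {0..1})) * indicator {0..1} t"
      using AE_lborel_singleton[of \<tau>]
    proof eventually_elim
      case (elim t)
      show ?case
      proof (cases "t \<in> {0..\<tau>}")
        case True
        then have "t \<in> {0..<\<tau>}" "t \<in> {0..1}" using elim \<tau>01 by auto
        then show ?thesis using M[OF before, of t "\<gamma>' t"] True assms(1)
          by (simp add: \<gamma>'_def divide_inverse mult.commute)
      qed simp
    qed
  qed
  finally show ?thesis .
qed

text \<open>
  A locally uniform bound for the derivatives of horizontal disks at their centres is a lower
  bound for the directed norm, so each path pays for leaving a neighbourhood of its origin.
\<close>

lemma kobayashi_hyperbolic_if_disks_bounded:
  fixes \<xi> :: "complex ^ 'm \<Rightarrow> (complex ^ 'm) set"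
  assumes "\<And>R. \<exists>M. \<forall>f. horizontal_disk \<xi> f \<and> norm (f 0) \<le> R \<longrightarrow> norm (complex_velocity f 0) \<le> M"
  shows "kobayashi_hyperbolic \<xi>"
  unfolding kobayashi_hyperbolic_def
proof (intro allI impI)
  fix p q :: "complex ^ 'm" assume "p \<noteq> q"
  define r where "r = dist p q"
  have r: "r > 0" using \<open>p \<noteq> q\<close> by (simp add: r_def)
  obtain M0 where "\<And>f. horizontal_disk \<xi> f \<Longrightarrow> norm (f 0) \<le> norm p + r \<Longrightarrow> norm (complex_velocity f 0) \<le> M0"
    using assms by metis
  then have M0: "norm (complex_velocity f 0) \<le> max M0 1" if "horizontal_disk \<xi> f" "norm (f 0) \<le> norm p + r" for f
    using that by (metis max.coboundedI1)
  define M where "M = max M0 1"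
  have "M > 0" by (simp add: M_def)
  have "ennreal (r / M) \<le> directed_kobayashi_dist \<xi> p q"
    unfolding directed_kobayashi_dist_def
  proof (rule Inf_greatest, safe)
    fix \<gamma> assume \<gamma>: "horizontal_path \<xi> \<gamma>" "p = \<gamma> 0" "q = \<gamma> 1"
    show "ennreal (r / M) \<le> directed_length \<xi> \<gamma>"
    proof (rule directed_length_lower_bound[OF \<open>M > 0\<close> r _ \<gamma>(1)])
      fix x v assume "dist (\<gamma> 0) x \<le> r"
      then have "norm x \<le> norm p + r" using norm_triangle_sub[of x p] by (simp add: \<gamma>(2) dist_norm norm_minus_commute)
      then show "ennreal (norm v / M) \<le> directed_norm \<xi> x v"
        using M0 by (intro directed_norm_lower_bound \<open>M > 0\<close>) (auto simp: M_def)
    qed (simp add: r_def \<gamma>)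
  qed
  moreover have "0 < ennreal (r / M)" using r \<open>M > 0\<close> by simp
  ultimately show "directed_kobayashi_dist \<xi> p q > 0" by (rule less_le_trans[rotated])
qed

section \<open>Hyperbolic contact structures\<close>

lemma norm_vec_le_card:
  fixes x :: "complex ^ 'm"
  assumes "\<And>i. cmod (x $ i) \<le> B"
  shows "norm x \<le> real CARD('m) * B"
proof -
  have "norm x \<le> (\<Sum>i\<in>UNIV. cmod (x $ i))"
    unfolding norm_vec_def by (rule L2_set_le_sum) simp
  also have "\<dots> \<le> real CARD('m) * B" using sum_bounded_above[of UNIV "\<lambda>i. cmod (x $ i)" B] assms by simp
  finally show ?thesis .
qed

text \<open>
  The bound for the coordinates on the disk of radius \<open>1 / 2\<close> bounds their derivatives at the
  centre; the derivative of \<open>w\<close> then follows from horizontality, as \<open>e\<^sup>w\<close> is bounded below at the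
  centre.
\<close>

theorem theorem1p2:
  fixes n :: nat
  assumes "n \<ge> 1"
    and "CARD('m::finite) = 2 * n + 1"
  shows "\<exists>\<alpha> :: complex ^ 'm \<Rightarrow> complex ^ 'm \<Rightarrow> complex.
           holomorphic_contact_form n \<alpha> \<and> kobayashi_hyperbolic (kernel_bundle \<alpha>)"
proof -
  have n: "n > 0" using assms(1) by simp
  obtain e :: "nat \<Rightarrow> 'm" where e: "bij_betw e {..2 * n} UNIV"
    using ex_bij_betw_nat_finite[of "UNIV :: 'm set"] assms(2)
    by (auto simp: atLeast0LessThan lessThan_Suc_atMost)
  obtain d where d: "\<And>m. Suc m \<le> d m" "\<And>m. admissible_exponent n d m (d m)"
    using exponents_exist by blast
  define P where "P = lacunary_potential (2 * n) d"
  define P' where "P' i = deriv (P i)" for i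
  have "k \<le> d k" for k using d(1)[of k] by simp
  note potential = lacunary_potential[of d, OF this, where L = "2 * n", folded P_def]
  have P: "(P i has_field_derivative P' i u) (at u)" for i u
    unfolding P'_def using potential(2) by (intro holomorphic_derivI[of _ UNIV]) auto
  have P'': "(P' i has_field_derivative deriv (P' i) u) (at u)" for i u
    unfolding P'_def using potential(2) by (intro holomorphic_derivI[of _ UNIV] holomorphic_deriv) auto
  define \<alpha> where "\<alpha> = exp_form n e P'"
  have "holomorphic_contact_form n \<alpha>"
    unfolding \<alpha>_def by (rule holomorphic_contact_form_exp_form[OF P'' bij_betw_imp_inj_on[OF e]])
  moreover have "kobayashi_hyperbolic (kernel_bundle \<alpha>)"
  proof (rule kobayashi_hyperbolic_if_disks_bounded)
    fix R :: real
    define m where "m = nat \<lceil>R\<rceil>"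
    define A where "A = amplitude n m"
    have A: "A > 0" by (simp add: A_def amplitude_def threshold_pos)
    have "\<exists>G. \<forall>u\<in>cball 0 (real m). cmod (P' i u) \<le> G" for i
    proof -
      have "compact (P' i ` cball 0 (real m))"
        using P'' by (intro compact_continuous_image continuous_at_imp_continuous_on) (auto intro: DERIV_isCont)
      then show ?thesis using compact_imp_bounded bounded_iff by (metis imageI)
    qed
    then obtain G where G: "\<And>i u. u \<in> cball 0 (real m) \<Longrightarrow> cmod (P' i u) \<le> G i" by metis
    define B where "B = real n * (A * (2 * A)) + (\<Sum>i<2 * n. G i * (2 * A))"
    define M where "M = max (2 * A) (exp (real m) * B)"
    have "norm (complex_velocity f 0) \<le> real CARD('m) * M"
      if f: "horizontal_disk (kernel_bundle \<alpha>) f" "norm (f 0) \<le> R" for f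
    proof (rule norm_vec_le_card)
      define c where "c = (\<lambda>i t. f t $ e i)"
      have hol: "c i holomorphic_on ball 0 1" for i
        using f(1) by (simp add: horizontal_disk_def c_def)
      have init: "cmod (c i 0) \<le> real m" for i
      proof -
        have "cmod (c i 0) \<le> norm (f 0)" unfolding c_def by (rule Finite_Cartesian_Product.norm_nth_le)
        with f(2) show ?thesis unfolding m_def by linarith
      qed
      have eq: "exp (c (2 * n) t) * deriv (c (2 * n)) t + (\<Sum>i<2 * n. P' i (c i t) * deriv (c i) t)
          = (\<Sum>j<n. c (2 * j) t * deriv (c (2 * j + 1)) t)" if "t \<in> ball 0 1" for t
        using horizontal_disk_exp_form[OF f(1)[unfolded \<alpha>_def] that] by (simp add: c_def)
      have cA: "cmod (c i t) \<le> A" if "i < 2 * n" "t \<in> cball 0 (1 / 2)" for i t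
        unfolding A_def
        by (rule horizontal_disk_coordinate_bound[where d = d and P = P and P' = P' and w = "c (2 * n)"])
           (use n d potential(1) P hol eq init that in auto)
      have c': "cmod (deriv (c i) 0) \<le> 2 * A" if "i < 2 * n" for i
      proof -
        have "cball 0 (1 / 2) \<subseteq> ball (0::complex) 1" by auto
        from norm_deriv_le[OF hol this, of i A] cA[OF that] show ?thesis by simp
      qed
      have w': "cmod (deriv (c (2 * n)) 0) \<le> exp (real m) * B"
      proof -
        have "exp (c (2 * n) 0) * deriv (c (2 * n)) 0 =
            (\<Sum>j<n. c (2 * j) 0 * deriv (c (2 * j + 1)) 0) - (\<Sum>i<2 * n. P' i (c i 0) * deriv (c i) 0)"
          using eq[of 0] by (simp add: algebra_simps)
        also have "cmod \<dots> \<le> (\<Sum>j<n. A * (2 * A)) + (\<Sum>i<2 * n. G i * (2 * A))"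
          by (intro order_trans[OF norm_triangle_ineq4] add_mono sum_norm_le)
             (auto simp: norm_mult intro!: mult_mono cA c' G init order_trans[OF norm_ge_zero G] less_imp_le[OF A])
        finally have B: "cmod (exp (c (2 * n) 0) * deriv (c (2 * n)) 0) \<le> B" by (simp add: B_def)
        have "deriv (c (2 * n)) 0 = exp (- c (2 * n) 0) * (exp (c (2 * n) 0) * deriv (c (2 * n)) 0)"
          by (simp add: exp_minus)
        also have "cmod \<dots> \<le> exp (real m) * B"
          unfolding norm_mult[of "exp (- c (2 * n) 0)"]
        proof (intro mult_mono B)
          show "cmod (exp (- c (2 * n) 0)) \<le> exp (real m)"
            by (rule order_trans[OF norm_exp]) (use init[of "2 * n"] in simp)
        qed auto
        finally show ?thesis .
      qed
      fix i :: 'm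
      obtain k where k: "k \<le> 2 * n" "i = e k" using e by (metis atMost_iff bij_betw_imp_surj_on imageE UNIV_I)
      have "complex_velocity f 0 $ i = deriv (c k) 0"
        by (simp add: complex_velocity_def c_def k(2))
      then show "cmod (complex_velocity f 0 $ i) \<le> M"
        using c'[of k] w' k(1) by (cases "k = 2 * n") (auto simp: M_def)
    qed
    then show "\<exists>M. \<forall>f. horizontal_disk (kernel_bundle \<alpha>) f \<and> norm (f 0) \<le> R \<longrightarrow> norm (complex_velocity f 0) \<le> M"
      by blast
  qed
  ultimately show ?thesis by blast
qed

end
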